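(* There exist infinitely many non-trivial complete $H$-minimal Lagrangian immersions of $\mathbb R^1\times S^{n-1}$ into $\mathbb{CP}^n$.
   Context: $\mathbb{CP}^n$ carries the Fubini–Study Kähler structure for which the Hopf map $S^{2n+1}(1)\to\mathbb{CP}^n$ is a Riemannian submersion. A Lagrangian submanifold (immersion) $L$ of a Kähler manifold $(M,\omega,g)$ is $H$-minimal (Hamiltonian minimal) if it is a critical point of the volume functional with respect to all (compactly supported) normal variations $W$ along $L$ for which the 1-form $\omega(W,\cdot)$ on $L$ is exact; equivalently $\delta\alpha_H=0$ on $L$, where $H$ is the mean curvature vector, $\alpha_H=\omega(H,\cdot)|_L$ and $\delta$ is the codifferential on $L$. An $H$-minimal Lagrangian submanifold is non-trivial if it is not minimal in the usual sense. Complete means that the induced metric is complete. *)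

theory Defs
  imports "HOL-Analysis.Analysis"
begin

section \<open>Smooth maps between Euclidean spaces\<close>

primrec Ck_on :: "nat \<Rightarrow> ('a::euclidean_space \<Rightarrow> 'b::real_normed_vector) \<Rightarrow> 'a set \<Rightarrow> bool" where
  "Ck_on 0 f U \<longleftrightarrow> continuous_on U f"
| "Ck_on (Suc k) f U \<longleftrightarrow>
     f differentiable_on U \<and> (\<forall>v. Ck_on k (\<lambda>x. frechet_derivative f (at x) v) U)"

text \<open>Only used for open \<open>U\<close>.\<close>
definition smooth_on :: "('a::euclidean_space \<Rightarrow> 'b::real_normed_vector) \<Rightarrow> 'a set \<Rightarrow> bool" where
  "smooth_on f U \<longleftrightarrow> (\<forall>k. Ck_on k f U)"

definition pd :: "'n::finite \<Rightarrow> (real^'n \<Rightarrow> 'b::real_normed_vector) \<Rightarrow> real^'n \<Rightarrow> 'b" where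
  "pd i f u = frechet_derivative f (at u) (axis i 1)"


section \<open>Complex projective space\<close>

text \<open>
  For an index type \<open>'m\<close>, the type \<open>'m cproj\<close> is the projective space of \<open>complex^'m\<close>, that is
  \<open>CP^n\<close> for \<open>CARD('m) = n + 1\<close>, realised as the quotient of the unit sphere by the circle action.
\<close>

definition circle_orbit :: "complex^'m \<Rightarrow> (complex^'m) set" where
  "circle_orbit z = {c *s z | c. cmod c = 1}"

typedef (overloaded) 'm cproj = "circle_orbit ` (sphere 0 1 :: (complex^'m::finite) set)"
  by (intro exI[of _ "circle_orbit (axis undefined 1)"] imageI) (simp add: norm_axis_1)

definition hopf :: "complex^'m::finite \<Rightarrow> 'm cproj" where
  "hopf z = Abs_cproj (circle_orbit z)"

definition herm :: "complex^'m::finite \<Rightarrow> complex^'m \<Rightarrow> complex" where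
  "herm z w = (\<Sum>i\<in>UNIV. z $ i * cnj (w $ i))"

text \<open>
  Let \<open>norm z = 1\<close>.  The tangent space of projective space at \<open>hopf z\<close> is identified, through the
  differential of \<open>hopf\<close> at \<open>z\<close>, with the horizontal space \<open>{v. herm v z = 0}\<close>, the orthogonal
  complement of \<open>z\<close> and of the fibre direction \<open>\<i> *s z\<close>.  As \<open>hopf\<close> is a Riemannian submersion, the
  Fubini-Study metric is then the restriction of the Euclidean inner product (the real part of
  \<open>herm\<close>), the complex structure is multiplication by \<open>\<i>\<close>, and the Kaehler form is \<open>kform\<close>.
  All three are unchanged when \<open>z\<close> and the tangent vectors are multiplied by a common phase.
\<close>

definition hor :: "complex^'m::finite \<Rightarrow> complex^'m \<Rightarrow> complex^'m" where
  "hor z v = v - herm v z *s z"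

definition kform :: "complex^'m::finite \<Rightarrow> complex^'m \<Rightarrow> real" where
  "kform v w = (\<i> *s v) \<bullet> w"

text \<open>
  The geodesic distance of this Fubini-Study metric: the spherical distance between the two fibres,
  i.e. the minimum of \<open>arccos (Re (herm z w))\<close> over representatives.
\<close>
definition fs_dist :: "'m::finite cproj \<Rightarrow> 'm cproj \<Rightarrow> real" where
  "fs_dist p q = arccos (cmod (herm (SOME z. z \<in> Rep_cproj p) (SOME w. w \<in> Rep_cproj q)))"

definition fs_isometry :: "('m::finite cproj \<Rightarrow> 'm cproj) \<Rightarrow> bool" where
  "fs_isometry \<Phi> \<longleftrightarrow> bij \<Phi> \<and> (\<forall>p q. fs_dist (\<Phi> p) (\<Phi> q) = fs_dist p q)"


section \<open>The manifold \<open>R \<times> S^(n-1)\<close> and lifts of maps into projective space\<close>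

definition cylinder :: "(real \<times> (real^'n::finite)) set" where
  "cylinder = UNIV \<times> sphere 0 1"

text \<open>
  The cylinder has dimension \<open>n = CARD('n)\<close>, so an injective immersion of an open subset of
  \<open>real^'n\<close> is the inverse of a smooth chart.
\<close>
definition local_param :: "(real^'n::finite \<Rightarrow> real \<times> (real^'n)) \<Rightarrow> (real^'n) set \<Rightarrow> bool" where
  "local_param \<psi> U \<longleftrightarrow> open U \<and> smooth_on \<psi> U \<and> inj_on \<psi> U \<and> \<psi> ` U \<subseteq> cylinder \<and>
     (\<forall>u\<in>U. inj (frechet_derivative \<psi> (at u)))"

text \<open>\<open>F\<close> is a smooth lift to the unit sphere of the coordinate expression \<open>f \<circ> \<psi>\<close>.\<close>
definition coord_lift ::
  "(real \<times> (real^'n) \<Rightarrow> 'm::finite cproj) \<Rightarrow> (real^'n::finite \<Rightarrow> real \<times> (real^'n)) \<Rightarrow> (real^'n) set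
    \<Rightarrow> (real^'n \<Rightarrow> complex^'m) \<Rightarrow> bool" where
  "coord_lift f \<psi> U F \<longleftrightarrow> local_param \<psi> U \<and> smooth_on F U \<and>
     (\<forall>u\<in>U. norm (F u) = 1 \<and> hopf (F u) = f (\<psi> u))"

text \<open>
  Since \<open>hopf\<close> is a submersion with local sections, a map into projective space is smooth iff it
  has smooth local lifts to the sphere.
\<close>
definition smooth_map :: "(real \<times> (real^'n::finite) \<Rightarrow> 'm::finite cproj) \<Rightarrow> bool" where
  "smooth_map f \<longleftrightarrow> (\<forall>p\<in>cylinder. \<exists>\<psi> U F. coord_lift f \<psi> U F \<and> p \<in> \<psi> ` U)"


section \<open>Submanifold geometry in terms of a lift\<close>

text \<open>
  \<open>F\<close> is a lift as above.  A vector field along \<open>f \<circ> \<psi>\<close> is represented by its horizontal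
  representatives at the points \<open>F u\<close>; \<open>frame F i\<close> represents the \<open>i\<close>-th coordinate field.
\<close>

definition hdiff :: "(real^'n::finite \<Rightarrow> complex^'m::finite) \<Rightarrow> real^'n \<Rightarrow> real^'n \<Rightarrow> complex^'m" where
  "hdiff F u v = hor (F u) (frechet_derivative F (at u) v)"

definition frame :: "(real^'n::finite \<Rightarrow> complex^'m::finite) \<Rightarrow> 'n \<Rightarrow> real^'n \<Rightarrow> complex^'m" where
  "frame F i u = hdiff F u (axis i 1)"

definition gmat :: "(real^'n::finite \<Rightarrow> complex^'m::finite) \<Rightarrow> real^'n \<Rightarrow> real^'n^'n" where
  "gmat F u = (\<chi> i j. frame F i u \<bullet> frame F j u)"

definition ginv :: "(real^'n::finite \<Rightarrow> complex^'m::finite) \<Rightarrow> real^'n \<Rightarrow> real^'n^'n" where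
  "ginv F u = matrix_inv (gmat F u)"

text \<open>
  The Levi-Civita connection of the Fubini-Study metric along \<open>f \<circ> \<psi>\<close>.  For a Riemannian submersion
  the covariant derivative of the base lifts to the horizontal part of the covariant derivative
  upstairs, provided one differentiates along a horizontal lift.  At a point where
  \<open>pd i F u\<close> is horizontal this gives \<open>hor (F u) (pd i V u)\<close>.  In general one first makes \<open>F\<close>
  horizontal in the \<open>i\<close>-th direction by a phase change \<open>exp (\<i> * \<phi>) *s F\<close>, where
  \<open>\<i> * pd i \<phi> = - herm (pd i F u) (F u)\<close> (the latter is purely imaginary as \<open>norm F = 1\<close>), and
  \<open>V\<close> changes by the same phase; this produces the second term.
\<close>
definition cov_deriv ::
  "(real^'n::finite \<Rightarrow> complex^'m::finite) \<Rightarrow> 'n \<Rightarrow> (real^'n \<Rightarrow> complex^'m) \<Rightarrow> real^'n \<Rightarrow> complex^'m" where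
  "cov_deriv F i V u = hor (F u) (pd i V u) - herm (pd i F u) (F u) *s V u"

definition normal_part ::
  "(real^'n::finite \<Rightarrow> complex^'m::finite) \<Rightarrow> real^'n \<Rightarrow> complex^'m \<Rightarrow> complex^'m" where
  "normal_part F u v =
     v - (\<Sum>i\<in>UNIV. \<Sum>j\<in>UNIV. (ginv F u $ i $ j * (v \<bullet> frame F i u)) *\<^sub>R frame F j u)"

definition second_ff ::
  "(real^'n::finite \<Rightarrow> complex^'m::finite) \<Rightarrow> 'n \<Rightarrow> 'n \<Rightarrow> real^'n \<Rightarrow> complex^'m" where
  "second_ff F i j u = normal_part F u (cov_deriv F i (frame F j) u)"

text \<open>The trace of the second fundamental form, without the factor \<open>1/n\<close>.\<close>
definition mean_curv :: "(real^'n::finite \<Rightarrow> complex^'m::finite) \<Rightarrow> real^'n \<Rightarrow> complex^'m" where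
  "mean_curv F u = (\<Sum>i\<in>UNIV. \<Sum>j\<in>UNIV. ginv F u $ i $ j *\<^sub>R second_ff F i j u)"

definition alphaH :: "(real^'n::finite \<Rightarrow> complex^'m::finite) \<Rightarrow> 'n \<Rightarrow> real^'n \<Rightarrow> real" where
  "alphaH F j u = kform (mean_curv F u) (frame F j u)"

definition christoffel ::
  "(real^'n::finite \<Rightarrow> complex^'m::finite) \<Rightarrow> 'n \<Rightarrow> 'n \<Rightarrow> 'n \<Rightarrow> real^'n \<Rightarrow> real" where
  "christoffel F k i j u = (1/2) * (\<Sum>l\<in>UNIV. ginv F u $ k $ l *
     (pd i (\<lambda>w. gmat F w $ j $ l) u + pd j (\<lambda>w. gmat F w $ i $ l) u - pd l (\<lambda>w. gmat F w $ i $ j) u))"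

text \<open>The codifferential, minus the trace of the covariant derivative, of the 1-form with
  components \<open>\<alpha> j\<close>.\<close>
definition codiff ::
  "(real^'n::finite \<Rightarrow> complex^'m::finite) \<Rightarrow> ('n \<Rightarrow> real^'n \<Rightarrow> real) \<Rightarrow> real^'n \<Rightarrow> real" where
  "codiff F \<alpha> u = - (\<Sum>i\<in>UNIV. \<Sum>j\<in>UNIV. ginv F u $ i $ j *
     (pd i (\<alpha> j) u - (\<Sum>k\<in>UNIV. christoffel F k i j u * \<alpha> k u)))"


section \<open>Hamiltonian minimal Lagrangian immersions of \<open>R \<times> S^(n-1)\<close> into \<open>CP^n\<close>\<close>

definition lagrangian_immersion :: "(real \<times> (real^'n::finite) \<Rightarrow> 'n option cproj) \<Rightarrow> bool" where
  "lagrangian_immersion f \<longleftrightarrow> smooth_map f \<and>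
     (\<forall>\<psi> U F. coord_lift f \<psi> U F \<longrightarrow>
        (\<forall>u\<in>U. inj (hdiff F u) \<and> (\<forall>v w. kform (hdiff F u v) (hdiff F u w) = 0)))"

definition minimal :: "(real \<times> (real^'n::finite) \<Rightarrow> 'n option cproj) \<Rightarrow> bool" where
  "minimal f \<longleftrightarrow> (\<forall>\<psi> U F. coord_lift f \<psi> U F \<longrightarrow> (\<forall>u\<in>U. mean_curv F u = 0))"

definition H_minimal :: "(real \<times> (real^'n::finite) \<Rightarrow> 'n option cproj) \<Rightarrow> bool" where
  "H_minimal f \<longleftrightarrow> (\<forall>\<psi> U F. coord_lift f \<psi> U F \<longrightarrow> (\<forall>u\<in>U. codiff F (alphaH F) u = 0))"

text \<open>
  The distance of the induced metric: the infimum of the lengths of the \<open>C^1\<close> curves \<open>c\<close> in the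
  cylinder.  The length of \<open>c\<close> in the induced metric is the Fubini-Study length of \<open>f \<circ> c\<close>, computed
  from an arbitrary \<open>C^1\<close> lift \<open>\<sigma>\<close> of \<open>f \<circ> c\<close> to the sphere.  It is infinite between different
  components (for \<open>CARD('n) = 1\<close>).
\<close>
definition induced_dist ::
  "(real \<times> (real^'n::finite) \<Rightarrow> 'm::finite cproj) \<Rightarrow> real \<times> (real^'n) \<Rightarrow> real \<times> (real^'n) \<Rightarrow> ereal" where
  "induced_dist f p q = Inf {ereal (integral {0..1} (\<lambda>s. norm (hor (\<sigma> s) (vector_derivative \<sigma> (at s))))) | c \<sigma>.
     c C1_differentiable_on {0..1} \<and> \<sigma> C1_differentiable_on {0..1} \<and> c 0 = p \<and> c 1 = q \<and>
     (\<forall>s\<in>{0..1}. c s \<in> cylinder \<and> norm (\<sigma> s) = 1 \<and> hopf (\<sigma> s) = f (c s))}"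

definition complete_immersion :: "(real \<times> (real^'n::finite) \<Rightarrow> 'm::finite cproj) \<Rightarrow> bool" where
  "complete_immersion f \<longleftrightarrow> (\<forall>x :: nat \<Rightarrow> real \<times> (real^'n).
     (\<forall>k. x k \<in> cylinder) \<and> (\<forall>e>0. \<exists>N. \<forall>j\<ge>N. \<forall>k\<ge>N. induced_dist f (x j) (x k) < e) \<longrightarrow>
     (\<exists>p\<in>cylinder. (\<lambda>k. induced_dist f (x k) p) \<longlonglongrightarrow> 0))"

text \<open>
  Identification of immersions whose images agree up to an isometry of projective space.  It is
  coarser than equivalence under isometries of projective space and reparametrisations.
\<close>
definition congruent_images ::
  "(real \<times> (real^'n::finite) \<Rightarrow> 'm::finite cproj) \<Rightarrow> (real \<times> (real^'n) \<Rightarrow> 'm cproj) \<Rightarrow> bool" where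
  "congruent_images f g \<longleftrightarrow> (\<exists>\<Phi>. fs_isometry \<Phi> \<and> \<Phi> ` f ` cylinder = g ` cylinder)"

end

theory Submission
  imports Defs
begin

text \<open>
  For an angle \<open>\<theta>\<close> strictly between \<open>0\<close> and \<open>pi / 4\<close>, the map sending \<open>(t, x)\<close> to the class of
  \<open>(cos \<theta>, sin \<theta> * exp (\<i> * t) * x)\<close> is an immersion of \<open>R \<times> S^(n-1)\<close> (\<open>torus_map\<close>; the lift is
  \<open>torus_lift\<close>).  It covers a compact orbit of the group \<open>U(1) \<times> SO(n)\<close> of isometries.

  Its geometry is that of a product.  The induced metric is
  \<open>(sin \<theta> * cos \<theta>)\<^sup>2 dt\<^sup>2 + (sin \<theta>)\<^sup>2 g\<close>, with \<open>g\<close> the round metric of the sphere, and the Hermitian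
  products of horizontal tangent vectors are real, so the map is a Lagrangian immersion.  The cubic
  form \<open>\<omega>(\<nabla>\<^sub>i e\<^sub>j, e\<^sub>k)\<close> is
  a combination of \<open>dt\<^sup>3\<close> and the symmetrised product of \<open>dt\<close> with the metric; taking its trace gives
  \<open>\<alpha>\<^sub>H = (1 - (n + 1) * (cos \<theta>)\<^sup>2) dt\<close> (\<open>alphaH_eq\<close>).  In a product metric \<open>t\<close> has vanishing Hessian
  (\<open>christoffel_axial\<close>), so \<open>\<alpha>\<^sub>H\<close> is coclosed (\<open>codiff_alphaH\<close>) and the immersion is H-minimal; it is
  minimal only if \<open>(n + 1) * (cos \<theta>)\<^sup>2 = 1\<close>, which is impossible since \<open>(cos \<theta>)\<^sup>2 > 1/2\<close>.

  The defining properties quantify over all charts \<open>\<psi>\<close> and all lifts \<open>F\<close>.  Every lift is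
  \<open>torus_lift \<theta> \<circ> \<psi>\<close> times a phase function, and horizontal projection removes the derivative of the
  phase; this reduces all computations to the components of the first and second derivatives of
  \<open>\<psi>\<close> (locale \<open>torus_coord_lift\<close>).  Smoothness is tested in the single chart
  \<open>u \<mapsto> (ln \<bar>u\<bar>, u / \<bar>u\<bar>)\<close> of the punctured space.  Completeness holds because the induced distance
  dominates a multiple of the Euclidean distance (\<open>induced_dist_lower\<close>), while nearby points are
  joined by the image of a short segment in that chart (\<open>induced_dist_upper\<close>).

  The members of the family are told apart by the diameter of their images, which is \<open>2 * \<theta>\<close>: the
  Hermitian product of two points of the lift is \<open>(cos \<theta>)\<^sup>2 + (sin \<theta>)\<^sup>2 * z\<close> with \<open>z\<close> in the unit
  disk, and for \<open>\<theta> < pi / 4\<close> its modulus is least at \<open>z = -1\<close>, where it equals \<open>cos (2 * \<theta>)\<close>.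
\<close>

section \<open>Smooth functions on an open set\<close>

lemma Ck_on_differentiable:
  assumes "open U" "Ck_on (Suc k) f U" "x \<in> U"
  shows "(f has_derivative frechet_derivative f (at x)) (at x)"
proof -
  have "f differentiable (at x within U)"
    using assms by (simp add: differentiable_on_def)
  then show ?thesis
    using assms(1,3) frechet_derivative_works at_within_open by metis
qed

lemma Ck_on_cong:
  assumes "open U" "\<And>x. x \<in> U \<Longrightarrow> f x = g x" "Ck_on k f U"
  shows "Ck_on k g U"
  using assms(2,3)
proof (induction k arbitrary: f g)
  case 0
  then show ?case using continuous_on_cong by force
next
  case (Suc k)
  have D: "(g has_derivative frechet_derivative f (at x)) (at x)" if "x \<in> U" for x
    using has_derivative_transform_within_open[OF Ck_on_differentiable[OF assms(1) Suc.prems(2) that]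
        assms(1) that] Suc.prems(1) by blast
  have "g differentiable_on U"
    using D unfolding differentiable_on_def by (meson differentiable_at_withinI differentiable_def)
  moreover have "Ck_on k (\<lambda>x. frechet_derivative g (at x) v) U" for v
  proof (rule Suc.IH)
    show "Ck_on k (\<lambda>x. frechet_derivative f (at x) v) U"
      using Suc.prems by simp
    show "frechet_derivative f (at x) v = frechet_derivative g (at x) v" if "x \<in> U" for x
      using D[OF that] frechet_derivative_at by metis
  qed
  ultimately show ?case by simp
qed

lemma Ck_on_SucI:
  assumes "open U" "\<And>x. x \<in> U \<Longrightarrow> (f has_derivative f' x) (at x)"
    and "\<And>v. Ck_on k (\<lambda>x. f' x v) U"
  shows "Ck_on (Suc k) f U"
proof -
  have "f differentiable_on U"
    using assms(2) unfolding differentiable_on_def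
    by (meson differentiable_at_withinI differentiable_def)
  moreover have "Ck_on k (\<lambda>x. frechet_derivative f (at x) v) U" for v
  proof (rule Ck_on_cong[OF assms(1) _ assms(3)])
    show "f' x v = frechet_derivative f (at x) v" if "x \<in> U" for x
      using frechet_derivative_at[OF assms(2)[OF that]] by simp
  qed
  ultimately show ?thesis by simp
qed

lemma Ck_on_SucD:
  assumes "open U" "Ck_on (Suc k) f U"
  shows "Ck_on k f U"
  using assms(2)
proof (induction k arbitrary: f)
  case 0
  then show ?case by (simp add: differentiable_imp_continuous_on)
next
  case (Suc k)
  have "Ck_on (Suc k) (\<lambda>x. frechet_derivative f (at x) v) U" for v
    using Suc.prems unfolding Ck_on.simps(2)[of "Suc k"] by blast
  then have "Ck_on k (\<lambda>x. frechet_derivative f (at x) v) U" for v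
    by (rule Suc.IH)
  from Ck_on_SucI[OF assms(1) Ck_on_differentiable[OF assms(1) Suc.prems] this]
  show ?case by blast
qed

lemma Ck_on_const: "open U \<Longrightarrow> Ck_on k (\<lambda>x. c) U"
proof (induction k arbitrary: c)
  case (Suc k)
  show ?case
    by (rule Ck_on_SucI[OF Suc.prems, where f' = "\<lambda>x v. 0"]) (use Suc in auto)
qed simp

lemma Ck_on_bounded_linear:
  assumes "open U" "bounded_linear f"
  shows "Ck_on k f U"
proof (cases k)
  case 0
  then show ?thesis using assms by (simp add: linear_continuous_on)
next
  case (Suc j)
  show ?thesis unfolding Suc
    by (rule Ck_on_SucI[OF assms(1), where f' = "\<lambda>x. f"])
       (use assms Ck_on_const in \<open>auto simp: bounded_linear_imp_has_derivative\<close>)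
qed

lemma Ck_on_add:
  assumes "open U" "Ck_on k f U" "Ck_on k g U"
  shows "Ck_on k (\<lambda>x. f x + g x) U"
  using assms(2,3)
proof (induction k arbitrary: f g)
  case 0
  then show ?case by (simp add: continuous_on_add)
next
  case (Suc k)
  show ?case
    by (rule Ck_on_SucI[OF assms(1) has_derivative_add[OF Ck_on_differentiable[OF assms(1) Suc.prems(1)]
            Ck_on_differentiable[OF assms(1) Suc.prems(2)]]])
       (use Suc in auto)
qed

lemma Ck_on_bilinear:
  assumes "bounded_bilinear pr" and "open U" "Ck_on k f U" "Ck_on k g U"
  shows "Ck_on k (\<lambda>x. pr (f x) (g x)) U"
  using assms(3,4)
proof (induction k arbitrary: f g)
  case 0
  then show ?case using bounded_bilinear.continuous_on[OF assms(1)] by simp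
next
  case (Suc k)
  show ?case
  proof (rule Ck_on_SucI[OF assms(2) bounded_bilinear.FDERIV[OF assms(1)
          Ck_on_differentiable[OF assms(2) Suc.prems(1)] Ck_on_differentiable[OF assms(2) Suc.prems(2)]]])
    fix v
    show "Ck_on k (\<lambda>x. pr (f x) (frechet_derivative g (at x) v)
                     + pr (frechet_derivative f (at x) v) (g x)) U"
      using Ck_on_SucD[OF assms(2) Suc.prems(1)] Ck_on_SucD[OF assms(2) Suc.prems(2)] Suc.prems
      by (intro Ck_on_add assms(2) Suc.IH) simp_all
  qed
qed

lemma Ck_on_linear_compose:
  assumes "bounded_linear L" and "open U" "Ck_on k f U"
  shows "Ck_on k (\<lambda>x. L (f x)) U"
  using assms(3)
proof (induction k arbitrary: f)
  case 0
  then show ?case using bounded_linear.continuous_on[OF assms(1)] by simp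
next
  case (Suc k)
  have "Ck_on k (\<lambda>x. L (frechet_derivative f (at x) v)) U" for v
    by (rule Suc.IH) (use Suc.prems in simp)
  from Ck_on_SucI[OF assms(2) bounded_linear.has_derivative[OF assms(1) Ck_on_differentiable[OF assms(2) Suc.prems]] this]
  show ?case by blast
qed

text \<open>Differentiating \<open>exp \<circ> L\<close> reproduces \<open>exp \<circ> L\<close> multiplied by a factor that is as smooth as
  the derivative of \<open>L\<close>, so the order of smoothness can be raised one step at a time; the same
  works for the inverse norm, and \<open>ln (norm u)\<close> has a derivative built from the latter.\<close>

lemma Ck_on_exp:
  fixes L :: "'a::euclidean_space \<Rightarrow> complex"
  assumes "open U" "Ck_on k L U"
  shows "Ck_on k (\<lambda>x. exp (L x)) U"
  using assms(2)
proof (induction k)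
  case 0
  then show ?case by (simp add: continuous_on_exp)
next
  case (Suc k)
  show ?case
  proof (rule Ck_on_SucI[OF assms(1)])
    show "((\<lambda>x. exp (L x)) has_derivative (\<lambda>v. exp (L x) * frechet_derivative L (at x) v)) (at x)"
      if "x \<in> U" for x
      by (rule has_derivative_compose[OF Ck_on_differentiable[OF assms(1) Suc.prems that],
            where g = exp and g' = "(*) (exp (L x))"])
         (use DERIV_exp in \<open>simp add: has_field_derivative_def\<close>)
    show "Ck_on k (\<lambda>x. exp (L x) * frechet_derivative L (at x) v) U" for v
      using Suc.IH[OF Ck_on_SucD[OF assms(1) Suc.prems]] Suc.prems
      by (intro Ck_on_bilinear[OF bounded_bilinear_mult assms(1)]) simp_all
  qed
qed

lemma open_punctured: "open (UNIV - {0 :: 'a::euclidean_space})"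
  by (simp add: open_delete)

lemma has_derivative_norm_at:
  "u \<noteq> 0 \<Longrightarrow> (norm has_derivative (\<lambda>v. (u \<bullet> v) / norm u)) (at u)" for u :: "'a::euclidean_space"
  using GDERIV_norm[of u]
  by (simp add: gderiv_def sgn_div_norm divide_inverse mult.commute inner_commute)

lemma Ck_on_inverse_norm: "Ck_on k (\<lambda>u. inverse (norm u)) (UNIV - {0 :: 'a::euclidean_space})"
proof (induction k)
  case 0
  then show ?case by (auto intro!: continuous_intros)
next
  case (Suc k)
  let ?r = "\<lambda>u::'a. inverse (norm u)"
  show ?case
  proof (rule Ck_on_SucI[OF open_punctured])
    show "(?r has_derivative (\<lambda>v. - (?r u * (?r u * (?r u * (u \<bullet> v)))))) (at u)"
      if "u \<in> UNIV - {0}" for u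
      using that by (auto intro!: derivative_eq_intros ext has_derivative_norm_at simp: inner_commute divide_simps)
    show "Ck_on k (\<lambda>u. - (?r u * (?r u * (?r u * (u \<bullet> v))))) (UNIV - {0})" for v
      using Ck_on_bilinear[OF bounded_bilinear_mult open_punctured Ck_on_const[OF open_punctured, of k "-1"]
            Ck_on_bilinear[OF bounded_bilinear_mult open_punctured Suc
             Ck_on_bilinear[OF bounded_bilinear_mult open_punctured Suc
              Ck_on_bilinear[OF bounded_bilinear_mult open_punctured Suc
               Ck_on_bounded_linear[OF open_punctured bounded_linear_inner_left[of v]]]]]]
      by simp
  qed
qed

lemma Ck_on_ln_norm: "Ck_on k (\<lambda>u. ln (norm u)) (UNIV - {0 :: 'a::euclidean_space})"
proof (cases k)
  case 0
  then show ?thesis by (auto intro!: continuous_intros)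
next
  case (Suc j)
  let ?r = "\<lambda>u::'a. inverse (norm u)"
  show ?thesis unfolding Suc
  proof (rule Ck_on_SucI[OF open_punctured])
    show "((\<lambda>u. ln (norm u)) has_derivative (\<lambda>v. ?r u * (?r u * (u \<bullet> v)))) (at u)"
      if "u \<in> UNIV - {0}" for u
      using that by (auto intro!: derivative_eq_intros ext has_derivative_norm_at simp: inner_commute divide_simps)
    show "Ck_on j (\<lambda>u. ?r u * (?r u * (u \<bullet> v))) (UNIV - {0})" for v
      by (intro Ck_on_bilinear[OF bounded_bilinear_mult open_punctured] Ck_on_inverse_norm
           Ck_on_bounded_linear[OF open_punctured bounded_linear_inner_left])
  qed
qed

section \<open>Symmetry of second derivatives\<close>

lemma derivative_along_line:
  fixes f :: "'a::real_normed_vector \<Rightarrow> real"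
  assumes "(f has_derivative f') (at (p + s *\<^sub>R v))"
  shows "((\<lambda>s. f (p + s *\<^sub>R v)) has_real_derivative f' v) (at s)"
proof -
  have "((\<lambda>s. p + s *\<^sub>R v) has_derivative (\<lambda>z. z *\<^sub>R v)) (at s)"
    by (auto intro!: derivative_eq_intros)
  from has_derivative_compose[where g = f, OF this assms] 
  have "((\<lambda>s. f (p + s *\<^sub>R v)) has_derivative (\<lambda>z. f' (z *\<^sub>R v))) (at s)" .
  then show ?thesis
    using linear_cmul[OF has_derivative_linear[OF assms]]
    by (simp add: has_field_derivative_def mult_commute_abs)
qed

text \<open>Two applications of the mean value theorem write the second difference quotient as a value of
  the iterated directional derivative at a nearby point; continuity of the latter gives the limit.\<close>

lemma second_difference_limit:
  fixes f :: "'a::real_normed_vector \<Rightarrow> real"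
  assumes U: "open U" "u \<in> U"
    and f: "\<And>x. x \<in> U \<Longrightarrow> (f has_derivative f' x) (at x)"
    and f': "\<And>x. x \<in> U \<Longrightarrow> ((\<lambda>x. f' x v) has_derivative A x) (at x)"
    and cont: "continuous_on U (\<lambda>x. A x w)"
  shows "((\<lambda>h. (f (u + h *\<^sub>R v + h *\<^sub>R w) - f (u + h *\<^sub>R v) - f (u + h *\<^sub>R w) + f u) / h\<^sup>2)
          \<longlongrightarrow> A u w) (at_right 0)"
proof (rule tendstoI)
  fix e :: real assume e: "e > 0"
  obtain d0 where d0: "d0 > 0" "ball u d0 \<subseteq> U"
    using U openE by blast
  have "isCont (\<lambda>x. A x w) u" using cont U continuous_on_eq_continuous_at by blast
  then obtain d1 where d1: "d1 > 0" "\<And>x. dist x u < d1 \<Longrightarrow> dist (A x w) (A u w) < e"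
    using e unfolding continuous_at_eps_delta dist_norm by meson
  define d where "d = min d0 d1 / (norm v + norm w + 1)"
  have dpos: "d > 0" unfolding d_def using d0 d1 by (auto intro!: divide_pos_pos add_nonneg_pos)
  have near: "norm (s *\<^sub>R v + r *\<^sub>R w) < min d0 d1" if "0 \<le> s" "s < d" "0 \<le> r" "r < d" for s r
  proof -
    have "norm (s *\<^sub>R v + r *\<^sub>R w) \<le> s * norm v + r * norm w"
      using that by (intro norm_triangle_le) simp
    also have "\<dots> \<le> d * norm v + d * norm w"
      using that by (intro add_mono mult_right_mono) auto
    also have "\<dots> < d * (norm v + norm w + 1)" using dpos by (simp add: algebra_simps)
    also have "\<dots> = min d0 d1" unfolding d_def
      by (smt (verit) norm_ge_zero nonzero_eq_divide_eq)
    finally show ?thesis .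
  qed
  have inU: "u + s *\<^sub>R v + r *\<^sub>R w \<in> U" if "0 \<le> s" "s < d" "0 \<le> r" "r < d" for s r
    using near[OF that] d0(2)
    by (auto simp: dist_norm subset_iff mem_ball norm_minus_commute add.assoc)
  have "dist ((f (u + h *\<^sub>R v + h *\<^sub>R w) - f (u + h *\<^sub>R v) - f (u + h *\<^sub>R w) + f u) / h\<^sup>2) (A u w) < e"
    if h: "0 < h" "h < d" for h
  proof -
    have "\<exists>s. 0 < s \<and> s < h \<and>
        (f (u + h *\<^sub>R w + h *\<^sub>R v) - f (u + h *\<^sub>R v)) - (f (u + h *\<^sub>R w + 0 *\<^sub>R v) - f (u + 0 *\<^sub>R v))
        = (h - 0) * (f' (u + h *\<^sub>R w + s *\<^sub>R v) v - f' (u + s *\<^sub>R v) v)"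
    proof (rule MVT2[where f = "\<lambda>s. f (u + h *\<^sub>R w + s *\<^sub>R v) - f (u + s *\<^sub>R v)"])
      fix s assume s: "0 \<le> s" "s \<le> h"
      have "u + h *\<^sub>R w + s *\<^sub>R v \<in> U" "u + s *\<^sub>R v \<in> U"
        using inU[of s h] inU[of s 0] s h by (auto simp: algebra_simps)
      then show "((\<lambda>s. f (u + h *\<^sub>R w + s *\<^sub>R v) - f (u + s *\<^sub>R v)) has_real_derivative
          (f' (u + h *\<^sub>R w + s *\<^sub>R v) v - f' (u + s *\<^sub>R v) v)) (at s)"
        by (intro DERIV_diff derivative_along_line f)
    qed (use h in auto)
    then obtain s where s: "0 < s" "s < h"
       and S: "f (u + h *\<^sub>R v + h *\<^sub>R w) - f (u + h *\<^sub>R v) - f (u + h *\<^sub>R w) + f u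
          = h * (f' (u + s *\<^sub>R v + h *\<^sub>R w) v - f' (u + s *\<^sub>R v) v)" by (auto simp: algebra_simps)
    have "\<exists>r. 0 < r \<and> r < h \<and> f' (u + s *\<^sub>R v + h *\<^sub>R w) v - f' (u + s *\<^sub>R v + 0 *\<^sub>R w) v
        = (h - 0) * A (u + s *\<^sub>R v + r *\<^sub>R w) w"
      using inU h s by (intro MVT2[where f = "\<lambda>r. f' (u + s *\<^sub>R v + r *\<^sub>R w) v"]
          derivative_along_line[where f = "\<lambda>x. f' x v"] f') auto
    then obtain r where r: "0 < r" "r < h" 
      and R: "f' (u + s *\<^sub>R v + h *\<^sub>R w) v - f' (u + s *\<^sub>R v) v = h * A (u + s *\<^sub>R v + r *\<^sub>R w) w"
      by auto
    have "dist (u + s *\<^sub>R v + r *\<^sub>R w) u < d1"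
      using near[of s r] r s h by (simp add: dist_norm add.assoc)
    then have "dist (A (u + s *\<^sub>R v + r *\<^sub>R w) w) (A u w) < e" by (rule d1)
    then show ?thesis using S R h by (simp add: power2_eq_square)
  qed
  then show "\<forall>\<^sub>F h in at_right 0. dist ((f (u + h *\<^sub>R v + h *\<^sub>R w) - f (u + h *\<^sub>R v) - f (u + h *\<^sub>R w) + f u) / h\<^sup>2)
      (A u w) < e"
    unfolding eventually_at_right_field using dpos by blast
qed

lemma second_derivative_symmetric_real:
  fixes f :: "'a::euclidean_space \<Rightarrow> real"
  assumes U: "open U" "u \<in> U" and f: "Ck_on 2 f U"
  shows "frechet_derivative (\<lambda>x. frechet_derivative f (at x) v) (at u) w
       = frechet_derivative (\<lambda>x. frechet_derivative f (at x) w) (at u) v"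
proof -
  have f2: "Ck_on (Suc (Suc 0)) f U" using f by (simp add: numeral_2_eq_2)
  have lim: "((\<lambda>h. (f (u + h *\<^sub>R v + h *\<^sub>R w) - f (u + h *\<^sub>R v) - f (u + h *\<^sub>R w) + f u) / h\<^sup>2)
      \<longlongrightarrow> frechet_derivative (\<lambda>x. frechet_derivative f (at x) v) (at u) w) (at_right 0)" for v w
    by (rule second_difference_limit[OF U Ck_on_differentiable[OF U(1) f2] Ck_on_differentiable[OF U(1), of 0]])
       (use f2 in auto)
  show ?thesis
    using tendsto_unique[OF _ lim[of v w]] lim[of w v] by (simp add: algebra_simps)
qed

lemma pd_commute:
  fixes f :: "real^'n::finite \<Rightarrow> 'b::euclidean_space"
  assumes U: "open U" "u \<in> U" and f: "Ck_on 2 f U"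
  shows "pd i (pd j f) u = pd j (pd i f) u"
proof (rule euclidean_eqI)
  fix b :: 'b
  have f2: "Ck_on (Suc (Suc 0)) f U" using f by (simp add: numeral_2_eq_2)
  have fb: "frechet_derivative (\<lambda>x. f x \<bullet> b) (at x) v = frechet_derivative f (at x) v \<bullet> b" if "x \<in> U" for x v
    using frechet_derivative_at[OF has_derivative_inner_left[OF Ck_on_differentiable[OF U(1) f2 that], of b]]
    by (metis)
  have "Ck_on (Suc 0) (pd j f) U" for j
    using f2 unfolding pd_def by simp
  from bounded_linear.has_derivative[OF bounded_linear_inner_left[of b] Ck_on_differentiable[OF U(1) this U(2)]]
  have *: "((\<lambda>x. frechet_derivative (\<lambda>x. f x \<bullet> b) (at x) (axis j 1)) has_derivative
       (\<lambda>v. frechet_derivative (pd j f) (at u) v \<bullet> b)) (at u)" for j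
    by (rule has_derivative_transform_within_open[OF _ U]) (auto simp: fb pd_def)
  have "Ck_on 2 (\<lambda>x. f x \<bullet> b) U"
    by (rule Ck_on_bilinear[OF bounded_bilinear_inner U(1) f Ck_on_const[OF U(1)]])
  from second_derivative_symmetric_real[OF U this, of "axis j 1" "axis i 1"]
  show "pd i (pd j f) u \<bullet> b = pd j (pd i f) u \<bullet> b"
    using frechet_derivative_at[OF *[of j]] frechet_derivative_at[OF *[of i]]
    unfolding pd_def by metis
qed

section \<open>The Hermitian form and the Hopf map\<close>

lemma herm_add_left: "herm (a + b) w = herm a w + herm b w"
  by (simp add: herm_def sum.distrib algebra_simps)

lemma herm_add_right: "herm w (a + b) = herm w a + herm w b"
  by (simp add: herm_def sum.distrib algebra_simps)

lemma herm_diff_left: "herm (a - b) w = herm a w - herm b w"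
  by (simp add: herm_def sum_subtractf algebra_simps)

lemma herm_scale_left: "herm (c *s z) w = c * herm z w"
  by (simp add: herm_def sum_distrib_left algebra_simps)

lemma herm_scale_right: "herm z (c *s w) = cnj c * herm z w"
  by (simp add: herm_def sum_distrib_left algebra_simps)

lemmas herm_simps = herm_add_left herm_add_right herm_diff_left herm_scale_left herm_scale_right

lemma herm_commute: "herm w z = cnj (herm z w)"
  by (simp add: herm_def mult.commute)

lemma inner_eq_Re_herm: "v \<bullet> w = Re (herm v w)"
  by (simp add: inner_vec_def herm_def inner_complex_def)

lemma kform_eq_Im_herm: "kform v w = - Im (herm v w)"
  by (simp add: kform_def inner_eq_Re_herm herm_scale_left)

lemma scaleR_eq_scale: "r *\<^sub>R v = complex_of_real r *s v" for v :: "complex^'m"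
  by (simp add: vec_eq_iff complex_eq_iff)

lemma herm_self: "herm z z = complex_of_real ((norm z)\<^sup>2)"
  by (rule complex_eqI) (use herm_commute[of z z] in \<open>auto simp: power2_norm_eq_inner inner_eq_Re_herm complex_eq_iff\<close>)

lemma norm_scale: "norm (c *s z) = cmod c * norm z" for z :: "complex^'m"
proof -
  have "complex_of_real ((norm (c *s z))\<^sup>2) = complex_of_real ((cmod c * norm z)\<^sup>2)"
    unfolding herm_self[symmetric] herm_simps power_mult_distrib
    by (simp add: herm_self mult.assoc[symmetric]) (metis complex_norm_square mult.commute of_real_power)
  then show ?thesis unfolding of_real_eq_iff by (simp add: power2_eq_iff_nonneg)
qed

lemma scale_assoc: "a *s (b *s z) = (a * b) *s z" for z :: "complex^'m"
  by (simp add: vec_eq_iff)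

lemma circle_orbit_eq_iff:
  "circle_orbit z = circle_orbit w \<longleftrightarrow> (\<exists>c. cmod c = 1 \<and> z = c *s w)"
proof
  assume "circle_orbit z = circle_orbit w"
  moreover have "z \<in> circle_orbit z" unfolding circle_orbit_def by (auto intro!: exI[of _ 1])
  ultimately show "\<exists>c. cmod c = 1 \<and> z = c *s w" unfolding circle_orbit_def by auto
next
  assume "\<exists>c. cmod c = 1 \<and> z = c *s w"
  then obtain c where c: "cmod c = 1" "z = c *s w" by auto
  have "c * cnj c = 1" using c(1) by (simp add: complex_norm_square[symmetric])
  then have w: "w = cnj c *s z" by (simp add: c(2) scale_assoc mult.commute)
  show "circle_orbit z = circle_orbit w"
    unfolding circle_orbit_def
  proof (safe)
    fix d assume d: "cmod d = 1"
    show "\<exists>e. d *s z = e *s w \<and> cmod e = 1"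
      using c d by (intro exI[of _ "d * c"]) (simp add: scale_assoc norm_mult)
    show "\<exists>e. d *s w = e *s z \<and> cmod e = 1"
      using c d w by (intro exI[of _ "d * cnj c"]) (metis complex_mod_cnj mult_1 norm_mult scale_assoc)
  qed
qed

lemma Rep_hopf: "norm z = 1 \<Longrightarrow> Rep_cproj (hopf z) = circle_orbit z"
  unfolding hopf_def by (rule Abs_cproj_inverse) simp

lemma hopf_eq_iff:
  assumes "norm z = 1" "norm w = 1"
  shows "hopf z = hopf w \<longleftrightarrow> (\<exists>c. cmod c = 1 \<and> z = c *s w)"
  using Rep_hopf[OF assms(1)] Rep_hopf[OF assms(2)] circle_orbit_eq_iff Rep_cproj_inject by metis

lemma fs_dist_hopf:
  assumes "norm z = 1" "norm w = 1"
  shows "fs_dist (hopf z) (hopf w) = arccos (cmod (herm z w))"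
proof -
  have *: "(SOME y. y \<in> Rep_cproj (hopf z)) \<in> circle_orbit z" if "norm z = 1" for z :: "complex^'m::finite"
    unfolding Rep_hopf[OF that] by (rule someI[of _ z]) (auto simp: circle_orbit_def intro!: exI[of _ 1])
  obtain a b where "cmod a = 1" "(SOME y. y \<in> Rep_cproj (hopf z)) = a *s z"
      "cmod b = 1" "(SOME y. y \<in> Rep_cproj (hopf w)) = b *s w"
    using *[OF assms(1)] *[OF assms(2)] unfolding circle_orbit_def by auto
  then show ?thesis unfolding fs_dist_def by (simp add: herm_simps norm_mult)
qed

text \<open>Rescaling a lift by a phase function \<open>c\<close> adds to its derivatives a multiple of \<open>z\<close>, which the
  horizontal projection kills.\<close>

lemma hor_phase:
  assumes "cmod c = 1" "norm z = 1"
  shows "hor (c *s z) (a *s z + c *s v) = c *s hor z v"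
proof -
  have "c * cnj c = 1" using assms(1) by (simp add: complex_norm_square[symmetric])
  then have "(cnj c * (a + c * herm v z)) * c = a + c * herm v z" by (simp add: algebra_simps)
  then show ?thesis
    using assms(2) unfolding hor_def herm_simps
    by (simp add: herm_self scale_assoc vec_eq_iff algebra_simps)
qed

lemma herm_hor_left: "norm z = 1 \<Longrightarrow> herm (hor z v) z = 0"
  by (simp add: hor_def herm_simps herm_self)

section \<open>Coordinates adapted to \<open>complex \<times> complex^'n\<close>\<close>

definition cvec :: "real^'n \<Rightarrow> complex^'n" where
  "cvec x = (\<chi> j. complex_of_real (x $ j))"

definition join :: "complex \<Rightarrow> complex^'n \<Rightarrow> complex^'n option" where
  "join a y = (\<chi> i. case i of None \<Rightarrow> a | Some j \<Rightarrow> y $ j)"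

lemma join_nth [simp]: "join a y $ None = a" "join a y $ Some j = y $ j"
  by (simp_all add: join_def)

lemma join_eq_iff: "z = join a y \<longleftrightarrow> z $ None = a \<and> (\<forall>j. z $ Some j = y $ j)"
  unfolding vec_eq_iff by (metis join_nth option.exhaust)

lemma join_add: "join a y + join b z = join (a + b) (y + z)"
  by (simp add: join_eq_iff)

lemma herm_join: "herm (join a y) (join b z) = a * cnj b + herm y z"
  by (simp add: herm_def UNIV_option_conv sum.reindex)

lemma cvec_nth [simp]: "cvec x $ j = complex_of_real (x $ j)"
  by (simp add: cvec_def)

lemma herm_cvec: "herm (cvec x) (cvec y) = complex_of_real (x \<bullet> y)"
  by (simp add: herm_def inner_vec_def)

lemma has_derivative_cvec:
  "(x has_derivative x') F \<Longrightarrow> ((\<lambda>w. cvec (x w)) has_derivative (\<lambda>h. cvec (x' h))) F"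
  by (rule bounded_linear.has_derivative)
     (simp_all add: linear_conv_bounded_linear[symmetric] linear_iff vec_eq_iff complex_eq_iff)

lemma has_derivative_join:
  assumes "(a has_derivative a') (at u within S)" "(y has_derivative y') (at u within S)"
  shows "((\<lambda>w. join (a w) (y w)) has_derivative (\<lambda>h. join (a' h) (y' h))) (at u within S)"
proof -
  have "bounded_linear (\<lambda>p. join (fst p) (snd p))"
    by (simp add: linear_conv_bounded_linear[symmetric] linear_iff join_add)
       (auto simp: vec_eq_iff join_def split: option.split)
  from bounded_linear.has_derivative[OF this has_derivative_Pair[OF assms]] show ?thesis by simp
qed

lemma bounded_bilinear_scale: "bounded_bilinear (\<lambda>(c::complex) (z::complex^'m::finite). c *s z)"
  unfolding bilinear_conv_bounded_bilinear[symmetric] bilinear_def linear_iff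
  by (auto simp: vec_eq_iff algebra_simps)

lemmas has_derivative_scale = bounded_bilinear.FDERIV[OF bounded_bilinear_scale]

section \<open>The immersions and their frames\<close>

definition torus_lift :: "real \<Rightarrow> real \<times> (real^'n::finite) \<Rightarrow> complex^'n option" where
  "torus_lift \<theta> p = join (of_real (cos \<theta>)) ((of_real (sin \<theta>) * cis (fst p)) *s cvec (snd p))"

definition torus_map :: "real \<Rightarrow> real \<times> (real^'n::finite) \<Rightarrow> 'n option cproj" where
  "torus_map \<theta> p = hopf (torus_lift \<theta> p)"

text \<open>The differential of \<open>torus_lift \<theta>\<close> at \<open>p\<close>, before and after horizontal projection, applied to a
  vector \<open>q\<close> tangent to the cylinder.\<close>

definition torus_deriv :: "real \<Rightarrow> real \<times> (real^'n::finite) \<Rightarrow> real \<times> (real^'n) \<Rightarrow> complex^'n option" where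
  "torus_deriv \<theta> p q = join 0 ((of_real (sin \<theta>) * cis (fst p)) *s ((\<i> * fst q) *s cvec (snd p) + cvec (snd q)))"

definition torus_frame :: "real \<Rightarrow> real \<times> (real^'n::finite) \<Rightarrow> real \<times> (real^'n) \<Rightarrow> complex^'n option" where
  "torus_frame \<theta> p q = join (- \<i> * of_real ((sin \<theta>)\<^sup>2 * cos \<theta>) * fst q)
     ((of_real (sin \<theta>) * cis (fst p)) *s ((\<i> * of_real ((cos \<theta>)\<^sup>2) * fst q) *s cvec (snd p) + cvec (snd q)))"

lemma herm_torus_lift:
  "herm (torus_lift \<theta> p) (torus_lift \<theta> q)
   = of_real ((cos \<theta>)\<^sup>2) + of_real ((sin \<theta>)\<^sup>2) * cis (fst p - fst q) * (snd p \<bullet> snd q)"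
  by (simp add: torus_lift_def herm_join herm_simps herm_cvec cis_cnj power2_eq_square
       cis_divide[symmetric] divide_inverse)

lemma norm_torus_lift: "norm (snd p) = 1 \<Longrightarrow> norm (torus_lift \<theta> p) = 1"
proof -
  assume *: "norm (snd p) = 1"
  have "complex_of_real ((norm (torus_lift \<theta> p))\<^sup>2) = 1"
    using * unfolding herm_self[symmetric] herm_torus_lift
    by (simp add: dot_square_norm flip: of_real_power of_real_add)
  then show ?thesis by (simp add: power2_eq_1_iff del: of_real_power) (smt (verit) norm_ge_zero)
qed

lemma cis_mult_cnj: "cis a * cnj (cis a) = 1"
  by (simp add: cis_cnj cis_mult)

lemma sin_sq_complex: "(complex_of_real (sin \<theta>))\<^sup>2 = 1 - (complex_of_real (cos \<theta>))\<^sup>2"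
  by (simp add: sin_squared_eq flip: of_real_power)

lemma herm_torus_deriv_lift:
  assumes "norm (snd p) = 1" "snd p \<bullet> snd q = 0"
  shows "herm (torus_deriv \<theta> p q) (torus_lift \<theta> p) = \<i> * of_real ((sin \<theta>)\<^sup>2) * fst q"
  using assms cis_mult_cnj[of "fst p"]
  by (simp add: torus_lift_def torus_deriv_def herm_join herm_simps herm_cvec dot_square_norm
      inner_commute power2_eq_square algebra_simps)

lemma hor_torus_deriv:
  assumes "norm (snd p) = 1" "snd p \<bullet> snd q = 0"
  shows "hor (torus_lift \<theta> p) (torus_deriv \<theta> p q) = torus_frame \<theta> p q"
proof -
  have "(complex_of_real (sin \<theta>))^3 = complex_of_real (sin \<theta>) * (1 - (complex_of_real (cos \<theta>))\<^sup>2)"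
    unfolding sin_sq_complex[symmetric] by (simp add: power2_eq_square power3_eq_cube)
  then show ?thesis
    unfolding hor_def herm_torus_deriv_lift[OF assms]
    by (simp add: torus_deriv_def torus_lift_def torus_frame_def join_eq_iff sin_sq_complex)
       (simp add: algebra_simps)
qed

text \<open>The real part is the induced metric, a product metric; the imaginary part is the Kaehler form,
  so the Lagrangian condition is that the right-hand side is real.  The vertical component removed by
  \<open>hor\<close> turns the factor \<open>(sin \<theta>)\<^sup>2\<close> of \<open>dt\<^sup>2\<close> into \<open>(sin \<theta>)\<^sup>2 - (sin \<theta>)^4\<close>.\<close>

lemma herm_torus_frame:
  assumes "norm (snd p) = 1" "snd p \<bullet> snd q = 0" "snd p \<bullet> snd r = 0"
  shows "herm (torus_frame \<theta> p q) (torus_frame \<theta> p r)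
    = complex_of_real ((sin \<theta>)\<^sup>2 * (cos \<theta>)\<^sup>2 * (fst q * fst r) + (sin \<theta>)\<^sup>2 * (snd q \<bullet> snd r))"
proof -
  have "herm (torus_frame \<theta> p q) (torus_frame \<theta> p r)
    = complex_of_real (((sin \<theta>)\<^sup>2 * cos \<theta>)\<^sup>2 * (fst q * fst r))
    + complex_of_real ((sin \<theta>)\<^sup>2) * (cis (fst p) * cnj (cis (fst p)))
       * complex_of_real ((cos \<theta>)^4 * (fst q * fst r) + snd q \<bullet> snd r)"
    using assms
    by (simp add: torus_frame_def herm_join herm_simps herm_cvec dot_square_norm
      inner_commute power2_eq_square algebra_simps eval_nat_numeral)
  also have "\<dots> = complex_of_real (((sin \<theta>)\<^sup>2 * cos \<theta>)\<^sup>2 * (fst q * fst r)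
       + (sin \<theta>)\<^sup>2 * ((cos \<theta>)^4 * (fst q * fst r) + snd q \<bullet> snd r))"
    unfolding cis_mult_cnj by simp
  also have "((sin \<theta>)\<^sup>2 * cos \<theta>)\<^sup>2 * (fst q * fst r)
       + (sin \<theta>)\<^sup>2 * ((cos \<theta>)^4 * (fst q * fst r) + snd q \<bullet> snd r)
    = (sin \<theta>)\<^sup>2 * (cos \<theta>)\<^sup>2 * ((sin \<theta>)\<^sup>2 + (cos \<theta>)\<^sup>2) * (fst q * fst r) + (sin \<theta>)\<^sup>2 * (snd q \<bullet> snd r)"
    by algebra
  finally show ?thesis by simp
qed

lemma has_derivative_cis:
  assumes "(f has_derivative f') (at u within S)"
  shows "((\<lambda>w. cis (f w)) has_derivative (\<lambda>h. \<i> * f' h * cis (f u))) (at u within S)"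
proof -
  have "((\<lambda>w. \<i> * complex_of_real (f w)) has_derivative (\<lambda>h. \<i> * complex_of_real (f' h))) (at u within S)"
    using assms by (auto intro!: derivative_eq_intros)
  from has_derivative_compose[OF this, where g = exp and g' = "(*) (exp (\<i> * complex_of_real (f u)))"]
  show ?thesis
    using DERIV_exp[of "\<i> * complex_of_real (f u)"]
    by (simp add: has_field_derivative_def cis_conv_exp mult_ac)
qed

lemma has_derivative_torus_lift:
  assumes "(p has_derivative p') (at u within S)"
  shows "((\<lambda>w. torus_lift \<theta> (p w)) has_derivative (\<lambda>h. torus_deriv \<theta> (p u) (p' h))) (at u within S)"
proof -
  have "((\<lambda>w. cis (fst (p w))) has_derivative (\<lambda>h. \<i> * fst (p' h) * cis (fst (p u)))) (at u within S)"
    by (rule has_derivative_cis[OF has_derivative_fst[OF assms]])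
  from has_derivative_join[OF has_derivative_const has_derivative_scale[OF
         has_derivative_mult_right[OF this] has_derivative_cvec[OF has_derivative_snd[OF assms]]]]
  show ?thesis
    unfolding torus_lift_def
    by (rule has_derivative_eq_rhs) (auto simp: torus_deriv_def join_eq_iff algebra_simps)
qed

text \<open>The derivative of a frame field \<open>torus_frame \<theta> (p w) (q w)\<close>, where \<open>p\<close> and \<open>q\<close> have the
  derivatives \<open>dp\<close> and \<open>dq\<close>.\<close>

definition torus_frame_deriv ::
  "real \<Rightarrow> real \<times> (real^'n::finite) \<Rightarrow> real \<times> (real^'n) \<Rightarrow> real \<times> (real^'n) \<Rightarrow> real \<times> (real^'n) \<Rightarrow> complex^'n option" where
  "torus_frame_deriv \<theta> p q dp dq = join (- \<i> * of_real ((sin \<theta>)\<^sup>2 * cos \<theta>) * fst dq)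
     ((of_real (sin \<theta>) * cis (fst p)) *s
       ((\<i> * fst dp) *s ((\<i> * of_real ((cos \<theta>)\<^sup>2) * fst q) *s cvec (snd p) + cvec (snd q))
        + ((\<i> * of_real ((cos \<theta>)\<^sup>2) * fst dq) *s cvec (snd p) + (\<i> * of_real ((cos \<theta>)\<^sup>2) * fst q) *s cvec (snd dp)
            + cvec (snd dq))))"

lemma has_derivative_torus_frame:
  assumes p: "(p has_derivative p') (at u)" and q: "(q has_derivative q') (at u)"
  shows "((\<lambda>w. torus_frame \<theta> (p w) (q w)) has_derivative
    (\<lambda>h. torus_frame_deriv \<theta> (p u) (q u) (p' h) (q' h))) (at u)"
proof -
  have 1: "((\<lambda>w. of_real (sin \<theta>) * cis (fst (p w))) has_derivative (\<lambda>h. of_real (sin \<theta>) * (\<i> * fst (p' h) * cis (fst (p u))))) (at u)"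
    by (rule has_derivative_mult_right[OF has_derivative_cis[OF has_derivative_fst[OF p]]])
  have 2: "((\<lambda>w. k * complex_of_real (fst (q w))) has_derivative (\<lambda>h. k * complex_of_real (fst (q' h)))) (at u)" for k
    by (rule has_derivative_mult_right[OF has_derivative_of_real[OF has_derivative_fst[OF q]]])
  show ?thesis
    unfolding torus_frame_def
    by (rule has_derivative_eq_rhs[OF has_derivative_join[OF 2 has_derivative_scale[OF 1
          has_derivative_add[OF has_derivative_scale[OF 2 has_derivative_cvec[OF has_derivative_snd[OF p]]]
            has_derivative_cvec[OF has_derivative_snd[OF q]]]]]])
       (auto simp: torus_frame_deriv_def join_eq_iff algebra_simps)
qed

text \<open>The assumption on \<open>dq\<close> is what differentiating \<open>snd p \<bullet> snd q = 0\<close> yields.  Otherwise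
  \<open>dq\<close>, which holds the second derivatives of the chart, contributes to the real part only.\<close>

lemma Im_herm_torus_frame_deriv:
  assumes p: "norm (snd p) = 1" and t: "snd p \<bullet> snd q = 0" "snd p \<bullet> snd dp = 0" "snd p \<bullet> snd r = 0"
    and dq: "snd p \<bullet> snd dq = - (snd dp \<bullet> snd q)"
  shows "Im (herm (torus_frame_deriv \<theta> p q dp dq) (torus_frame \<theta> p r))
    = (sin \<theta>)\<^sup>2 * ((cos \<theta>)^4 * (fst dp * fst q * fst r) + fst dp * (snd q \<bullet> snd r)
        + (cos \<theta>)\<^sup>2 * fst q * (snd dp \<bullet> snd r) + (cos \<theta>)\<^sup>2 * fst r * (snd dp \<bullet> snd q))"
proof -
  let ?e = "cis (fst p) * cnj (cis (fst p))"
  let ?c = "(cos \<theta>)\<^sup>2"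
  have "herm (torus_frame_deriv \<theta> p q dp dq) (torus_frame \<theta> p r)
    = complex_of_real (((sin \<theta>)\<^sup>2 * cos \<theta>)\<^sup>2 * (fst dq * fst r))
    + complex_of_real ((sin \<theta>)\<^sup>2) * ?e *
       (complex_of_real (?c * ?c * fst dq * fst r + snd dq \<bullet> snd r)
        + \<i> * complex_of_real (?c * ?c * (fst dp * fst q * fst r) + fst dp * (snd q \<bullet> snd r)
              + ?c * fst q * (snd dp \<bullet> snd r) + ?c * fst r * (snd dp \<bullet> snd q)))"
    using p t dq
    by (simp add: torus_frame_def torus_frame_deriv_def herm_join herm_simps herm_cvec dot_square_norm
        inner_commute[of "snd q" "snd p"] inner_commute[of "snd dq" "snd p"] inner_commute[of "snd dp" "snd p"])
       (simp add: algebra_simps power2_eq_square eval_nat_numeral)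
  then show ?thesis unfolding cis_mult_cnj by (simp add: power2_eq_square eval_nat_numeral)
qed

section \<open>Geometry of an arbitrary coordinate lift\<close>

lemma matrix_inv_mult:
  fixes A :: "real^'n^'n"
  assumes "invertible A"
  shows "(\<Sum>j\<in>UNIV. matrix_inv A $ i $ j * A $ j $ k) = (if i = k then 1 else 0)"
    and "(\<Sum>j\<in>UNIV. A $ i $ j * matrix_inv A $ j $ k) = (if i = k then 1 else 0)"
proof -
  have "A ** matrix_inv A = mat 1 \<and> matrix_inv A ** A = mat 1"
    using assms unfolding invertible_def matrix_inv_def by (rule someI_ex)
  then show "(\<Sum>j\<in>UNIV. matrix_inv A $ i $ j * A $ j $ k) = (if i = k then 1 else 0)"
    and "(\<Sum>j\<in>UNIV. A $ i $ j * matrix_inv A $ j $ k) = (if i = k then 1 else 0)"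
    by (simp_all add: matrix_matrix_mult_def mat_def vec_eq_iff)
qed

lemma pd_eqI:
  assumes "open U" "u \<in> U" "\<And>w. w \<in> U \<Longrightarrow> f w = g w" "(g has_derivative g') (at u)"
  shows "pd i f u = g' (axis i 1)"
proof -
  have "(f has_derivative g') (at u)"
    by (rule has_derivative_transform_within_open[OF assms(4,1,2)]) (simp add: assms(3))
  then show ?thesis unfolding pd_def by (metis frechet_derivative_at)
qed

text \<open>The phase \<open>phase u\<close> is read off the \<open>None\<close> component, on which \<open>torus_lift \<theta>\<close> is a positive
  constant; so it inherits the regularity of \<open>F\<close>.\<close>

locale torus_coord_lift =
  fixes \<theta> :: real and \<psi> :: "real^'n::finite \<Rightarrow> real \<times> (real^'n)" and U and F
  assumes \<theta>: "0 < \<theta>" "\<theta> < pi / 2"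
    and lift: "coord_lift (torus_map \<theta>) \<psi> U F"
begin

definition phase :: "real^'n \<Rightarrow> complex" where
  "phase u = F u $ None / of_real (cos \<theta>)"

lemma trig_pos: "0 < cos \<theta>" "0 < sin \<theta>"
  using \<theta> by (auto intro: cos_gt_zero sin_gt_zero2)

lemma open_U: "open U" and inj_chart: "u \<in> U \<Longrightarrow> inj (frechet_derivative \<psi> (at u))"
  and Ck_chart: "Ck_on k \<psi> U" and Ck_F: "Ck_on k F U"
  using lift unfolding coord_lift_def local_param_def smooth_on_def by auto

lemma norm_snd: "u \<in> U \<Longrightarrow> norm (snd (\<psi> u)) = 1"
  using lift unfolding coord_lift_def local_param_def cylinder_def by (force simp: mem_Times_iff)

lemma F_eq:
  assumes "u \<in> U"
  shows "F u = phase u *s torus_lift \<theta> (\<psi> u)" "cmod (phase u) = 1"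
proof -
  have "hopf (F u) = hopf (torus_lift \<theta> (\<psi> u))" "norm (F u) = 1"
    using lift assms unfolding coord_lift_def torus_map_def by auto
  then obtain c where c: "cmod c = 1" "F u = c *s torus_lift \<theta> (\<psi> u)"
    using hopf_eq_iff norm_torus_lift[OF norm_snd[OF assms]] by blast
  then have "phase u = c"
    using trig_pos by (simp add: phase_def torus_lift_def)
  then show "F u = phase u *s torus_lift \<theta> (\<psi> u)" "cmod (phase u) = 1" using c by auto
qed

lemma has_derivative_chart: "u \<in> U \<Longrightarrow> (\<psi> has_derivative frechet_derivative \<psi> (at u)) (at u)"
  by (rule Ck_on_differentiable[OF open_U Ck_chart[of "Suc 0"]])

lemma has_derivative_pd_chart:
  "u \<in> U \<Longrightarrow> (pd j \<psi> has_derivative frechet_derivative (pd j \<psi>) (at u)) (at u)"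
  using Ck_on_differentiable[OF open_U, of 0 "pd j \<psi>"] Ck_chart[of "Suc (Suc 0)"]
  unfolding pd_def by simp

lemma has_derivative_phase:
  "u \<in> U \<Longrightarrow> (phase has_derivative frechet_derivative phase (at u)) (at u)"
proof -
  assume u: "u \<in> U"
  have "((\<lambda>u. F u $ None) has_derivative (\<lambda>v. frechet_derivative F (at u) v $ None)) (at u)"
    by (rule bounded_linear.has_derivative[OF bounded_linear_vec_nth
          Ck_on_differentiable[OF open_U Ck_F[of "Suc 0"] u]])
  then have "(phase has_derivative (\<lambda>v. frechet_derivative F (at u) v $ None / of_real (cos \<theta>))) (at u)"
    unfolding phase_def using trig_pos by (auto intro!: derivative_eq_intros)
  then show ?thesis by (metis frechet_derivative_at)
qed

lemma tangent: "u \<in> U \<Longrightarrow> snd (\<psi> u) \<bullet> snd (frechet_derivative \<psi> (at u) v) = 0"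
proof -
  assume u: "u \<in> U"
  have "((\<lambda>w. snd (\<psi> w) \<bullet> snd (\<psi> w)) has_derivative
      (\<lambda>h. 2 * (snd (\<psi> u) \<bullet> snd (frechet_derivative \<psi> (at u) h)))) (at u)"
    using has_derivative_inner[OF has_derivative_snd[OF has_derivative_chart[OF u]]
        has_derivative_snd[OF has_derivative_chart[OF u]]]
    by (simp add: inner_commute)
  moreover have "((\<lambda>w. snd (\<psi> w) \<bullet> snd (\<psi> w)) has_derivative (\<lambda>h. 0)) (at u)"
    by (rule has_derivative_transform_within_open[OF has_derivative_const[of 1] open_U u])
       (simp add: dot_square_norm norm_snd)
  ultimately have "(\<lambda>h. 2 * (snd (\<psi> u) \<bullet> snd (frechet_derivative \<psi> (at u) h))) = (\<lambda>h. 0)"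
    by (rule has_derivative_unique)
  from fun_cong[OF this, of v] show ?thesis by simp
qed

lemma tangent_pd: "u \<in> U \<Longrightarrow> snd (\<psi> u) \<bullet> snd (pd j \<psi> u) = 0"
  by (simp add: pd_def tangent)

lemma tangent_pd2:
  assumes u: "u \<in> U"
  shows "snd (\<psi> u) \<bullet> snd (pd i (pd j \<psi>) u) = - (snd (pd i \<psi> u) \<bullet> snd (pd j \<psi> u))"
proof -
  have "((\<lambda>w. snd (\<psi> w) \<bullet> snd (pd j \<psi> w)) has_derivative
      (\<lambda>h. snd (\<psi> u) \<bullet> snd (frechet_derivative (pd j \<psi>) (at u) h) 
            + snd (frechet_derivative \<psi> (at u) h) \<bullet> snd (pd j \<psi> u))) (at u)"
    by (rule has_derivative_inner[OF has_derivative_snd[OF has_derivative_chart[OF u]]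
          has_derivative_snd[OF has_derivative_pd_chart[OF u]]])
  from pd_eqI[OF open_U u _ this, of "\<lambda>_. 0" i]
  have "pd i (\<lambda>_. 0::real) u = snd (\<psi> u) \<bullet> snd (pd i (pd j \<psi>) u) + snd (pd i \<psi> u) \<bullet> snd (pd j \<psi> u)"
    using tangent_pd by (simp add: pd_def[of i "pd j \<psi>"] pd_def[of i \<psi>])
  then show ?thesis by (simp add: pd_def)
qed

lemma has_derivative_F:
  assumes u: "u \<in> U"
  shows "(F has_derivative (\<lambda>v. frechet_derivative phase (at u) v *s torus_lift \<theta> (\<psi> u)
     + phase u *s torus_deriv \<theta> (\<psi> u) (frechet_derivative \<psi> (at u) v))) (at u)"
  by (rule has_derivative_transform_within_open[OF has_derivative_eq_rhs[OF has_derivative_scale[OF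
         has_derivative_phase[OF u] has_derivative_torus_lift[OF has_derivative_chart[OF u]]]] open_U u])
     (auto simp: F_eq add.commute)

lemma frechet_derivative_F:
  assumes u: "u \<in> U"
  shows "frechet_derivative F (at u) v = frechet_derivative phase (at u) v *s torus_lift \<theta> (\<psi> u)
     + phase u *s torus_deriv \<theta> (\<psi> u) (frechet_derivative \<psi> (at u) v)"
  using fun_cong[OF frechet_derivative_at[OF has_derivative_F[OF u]], of v] by simp

lemma hdiff_eq:
  assumes u: "u \<in> U"
  shows "hdiff F u v = phase u *s torus_frame \<theta> (\<psi> u) (frechet_derivative \<psi> (at u) v)"
  unfolding hdiff_def frechet_derivative_F[OF u] unfolding F_eq(1)[OF u]
  by (simp add: hor_phase F_eq u norm_torus_lift norm_snd hor_torus_deriv tangent)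

lemma frame_eq: "u \<in> U \<Longrightarrow> frame F j u = phase u *s torus_frame \<theta> (\<psi> u) (pd j \<psi> u)"
  by (simp add: frame_def hdiff_eq pd_def)

lemma phase_cancel: "u \<in> U \<Longrightarrow> phase u * (cnj (phase u) * z) = z"
  using F_eq(2)[of u] by (simp add: complex_norm_square[symmetric] flip: mult.assoc)

lemma herm_hdiff:
  assumes u: "u \<in> U"
  shows "herm (hdiff F u v) (hdiff F u w) = complex_of_real
     ((sin \<theta>)\<^sup>2 * (cos \<theta>)\<^sup>2 * (fst (frechet_derivative \<psi> (at u) v) * fst (frechet_derivative \<psi> (at u) w))
      + (sin \<theta>)\<^sup>2 * (snd (frechet_derivative \<psi> (at u) v) \<bullet> snd (frechet_derivative \<psi> (at u) w)))"
  using herm_torus_frame[OF norm_snd[OF u] tangent[OF u] tangent[OF u]]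
  by (simp only: hdiff_eq[OF u] herm_simps phase_cancel[OF u])
     (simp add: phase_cancel[OF u] mult.left_commute)

lemma gmat_eq:
  assumes u: "u \<in> U"
  shows "gmat F u $ i $ j = (sin \<theta>)\<^sup>2 * (cos \<theta>)\<^sup>2 * (fst (pd i \<psi> u) * fst (pd j \<psi> u))
      + (sin \<theta>)\<^sup>2 * (snd (pd i \<psi> u) \<bullet> snd (pd j \<psi> u))"
  by (simp add: gmat_def frame_def inner_eq_Re_herm herm_hdiff[OF u] pd_def)

lemma herm_frame: "u \<in> U \<Longrightarrow> herm (frame F i u) (frame F j u) = complex_of_real (gmat F u $ i $ j)"
  by (simp add: gmat_eq frame_def herm_hdiff pd_def)

lemma gmat_sym: "u \<in> U \<Longrightarrow> gmat F u $ i $ j = gmat F u $ j $ i"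
  by (simp add: gmat_eq inner_commute mult.commute)

text \<open>By dimension count the differential of a chart is onto the tangent space of the cylinder, so
  the axial direction is the image of a coordinate vector.\<close>

lemma axial_vector:
  assumes u: "u \<in> U"
  obtains w where "frechet_derivative \<psi> (at u) w = (1, 0)"
proof -
  let ?D = "frechet_derivative \<psi> (at u)"
  let ?T = "{q. (0, snd (\<psi> u)) \<bullet> q = 0} :: (real \<times> (real^'n)) set"
  have lin: "linear ?D" using has_derivative_chart[OF u] has_derivative_linear by blast
  have nz: "(0::real, snd (\<psi> u)) \<noteq> 0" using norm_snd[OF u] by (auto simp: zero_prod_def)
  have "dim (range ?D) = dim (UNIV :: (real^'n) set)"
    by (rule dim_image_eq[OF lin]) (use inj_chart[OF u] in simp)
  also have "\<dots> = dim ?T"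
    using dim_hyperplane[OF nz] by simp
  finally have "dim ?T \<le> dim (range ?D)" by simp
  moreover have "range ?D \<subseteq> ?T"
    using tangent[OF u] by (auto simp: inner_prod_def)
  ultimately have "range ?D = ?T"
    by (intro subspace_dim_equal) (auto simp: subspace_hyperplane lin linear_subspace_image)
  then have "(1, 0) \<in> range ?D" by (simp add: inner_prod_def)
  then show thesis using that by auto
qed

lemma frechet_chart_sum:
  assumes u: "u \<in> U"
  shows "frechet_derivative \<psi> (at u) w = (\<Sum>i\<in>UNIV. (w $ i) *\<^sub>R pd i \<psi> u)"
proof -
  have lin: "linear (frechet_derivative \<psi> (at u))"
    using has_derivative_chart[OF u] has_derivative_linear by blast
  have "frechet_derivative \<psi> (at u) w = frechet_derivative \<psi> (at u) (\<Sum>i\<in>UNIV. (w $ i) *\<^sub>R axis i 1)"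
    using basis_expansion[of w] by (simp add: scalar_mult_eq_scaleR)
  also have "\<dots> = (\<Sum>i\<in>UNIV. (w $ i) *\<^sub>R pd i \<psi> u)"
    by (simp add: linear_sum[OF lin] linear_cmul[OF lin] pd_def)
  finally show ?thesis .
qed

lemma gmat_mult:
  assumes u: "u \<in> U"
  shows "(\<Sum>j\<in>UNIV. gmat F u $ i $ j * w $ j)
    = (sin \<theta>)\<^sup>2 * (cos \<theta>)\<^sup>2 * (fst (pd i \<psi> u) * fst (frechet_derivative \<psi> (at u) w))
      + (sin \<theta>)\<^sup>2 * (snd (pd i \<psi> u) \<bullet> snd (frechet_derivative \<psi> (at u) w))"
  unfolding gmat_eq[OF u] frechet_chart_sum[OF u] fst_sum snd_sum inner_sum_right sum_distrib_left
    sum.distrib[symmetric]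
  by (intro sum.cong refl) (simp add: algebra_simps)

lemma invertible_gmat:
  assumes u: "u \<in> U"
  shows "invertible (gmat F u)"
proof -
  have "w = 0" if w: "gmat F u *v w = 0" for w
  proof -
    let ?D = "frechet_derivative \<psi> (at u) w"
    have "0 = (\<Sum>i\<in>UNIV. w $ i * (gmat F u *v w) $ i)" using w by simp
    also have "\<dots> = (sin \<theta>)\<^sup>2 * (cos \<theta>)\<^sup>2 * (fst (\<Sum>i\<in>UNIV. w $ i *\<^sub>R pd i \<psi> u) * fst ?D)
        + (sin \<theta>)\<^sup>2 * (snd (\<Sum>i\<in>UNIV. w $ i *\<^sub>R pd i \<psi> u) \<bullet> snd ?D)"
      unfolding matrix_vector_mult_def vec_lambda_beta gmat_mult[OF u] fst_sum snd_sum inner_sum_left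
        sum_distrib_left sum_distrib_right sum.distrib[symmetric]
      by (intro sum.cong refl) (simp add: algebra_simps)
    also have "\<dots> = (sin \<theta>)\<^sup>2 * (cos \<theta>)\<^sup>2 * (fst ?D)\<^sup>2 + (sin \<theta>)\<^sup>2 * (norm (snd ?D))\<^sup>2"
      unfolding frechet_chart_sum[OF u, symmetric] by (simp add: dot_square_norm power2_eq_square)
    finally have "fst ?D = 0" "snd ?D = 0"
      using trig_pos by (auto simp: add_nonneg_eq_0_iff)
    then have "?D = 0" by (simp add: prod_eq_iff)
    then show "w = 0"
      using inj_chart[OF u] linear_injective_0 has_derivative_linear[OF has_derivative_chart[OF u]] by blast
  qed
  then show ?thesis
    unfolding invertible_left_inverse matrix_left_invertible_ker by blast
qed

lemma ginv_gmat:
  assumes u: "u \<in> U"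
  shows "(\<Sum>j\<in>UNIV. ginv F u $ i $ j * gmat F u $ j $ k) = (if i = k then 1 else 0)"
    and "(\<Sum>j\<in>UNIV. gmat F u $ i $ j * ginv F u $ j $ k) = (if i = k then 1 else 0)"
  unfolding ginv_def by (rule matrix_inv_mult[OF invertible_gmat[OF u]])+

lemma gmat_axial:
  assumes u: "u \<in> U" and w: "frechet_derivative \<psi> (at u) w = (1, 0)"
  shows "(\<Sum>j\<in>UNIV. gmat F u $ i $ j * w $ j) = (sin \<theta>)\<^sup>2 * (cos \<theta>)\<^sup>2 * fst (pd i \<psi> u)"
  by (simp add: gmat_mult[OF u] w)

text \<open>The gradient of the axial coordinate is a multiple of the axial vector.  As the differential of
  that coordinate is a value of the metric, the inverse metric need not be computed.\<close>

lemma ginv_fst_pd: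
  assumes u: "u \<in> U" and w: "frechet_derivative \<psi> (at u) w = (1, 0)"
  shows "(\<Sum>k\<in>UNIV. fst (pd k \<psi> u) * ginv F u $ k $ l) = w $ l / ((sin \<theta>)\<^sup>2 * (cos \<theta>)\<^sup>2)"
proof -
  have "(sin \<theta>)\<^sup>2 * (cos \<theta>)\<^sup>2 * (\<Sum>k\<in>UNIV. fst (pd k \<psi> u) * ginv F u $ k $ l)
      = (\<Sum>k\<in>UNIV. (\<Sum>j\<in>UNIV. gmat F u $ k $ j * w $ j) * ginv F u $ k $ l)"
    unfolding gmat_axial[OF u w] by (simp add: sum_distrib_left mult_ac)
  also have "\<dots> = (\<Sum>k\<in>UNIV. \<Sum>j\<in>UNIV. w $ j * (gmat F u $ j $ k * ginv F u $ k $ l))"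
    unfolding sum_distrib_right by (intro sum.cong refl) (subst gmat_sym[OF u], simp add: mult_ac)
  also have "\<dots> = (\<Sum>j\<in>UNIV. w $ j * (\<Sum>k\<in>UNIV. gmat F u $ j $ k * ginv F u $ k $ l))"
    unfolding sum_distrib_left by (rule sum.swap)
  also have "\<dots> = w $ l" by (simp add: ginv_gmat[OF u] if_distrib[of "(*) _"] cong: if_cong)
  finally show ?thesis using trig_pos by (simp add: field_simps)
qed

lemma norm_sq_fst_pd:
  assumes u: "u \<in> U"
  shows "(\<Sum>i\<in>UNIV. \<Sum>j\<in>UNIV. ginv F u $ i $ j * (fst (pd i \<psi> u) * fst (pd j \<psi> u))) = 1 / ((sin \<theta>)\<^sup>2 * (cos \<theta>)\<^sup>2)"
proof -
  obtain w where w: "frechet_derivative \<psi> (at u) w = (1, 0)" using axial_vector[OF u] .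
  have "(\<Sum>i\<in>UNIV. \<Sum>j\<in>UNIV. ginv F u $ i $ j * (fst (pd i \<psi> u) * fst (pd j \<psi> u)))
     = (\<Sum>j\<in>UNIV. \<Sum>i\<in>UNIV. ginv F u $ i $ j * (fst (pd i \<psi> u) * fst (pd j \<psi> u)))"
    by (rule sum.swap)
  also have "\<dots> = (\<Sum>j\<in>UNIV. (\<Sum>i\<in>UNIV. fst (pd i \<psi> u) * ginv F u $ i $ j) * fst (pd j \<psi> u))"
    unfolding sum_distrib_right by (simp add: mult_ac)
  also have "\<dots> = (\<Sum>j\<in>UNIV. w $ j * fst (pd j \<psi> u)) / ((sin \<theta>)\<^sup>2 * (cos \<theta>)\<^sup>2)"
    unfolding ginv_fst_pd[OF u w] by (simp add: sum_divide_distrib)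
  also have "(\<Sum>j\<in>UNIV. w $ j * fst (pd j \<psi> u)) = 1"
    using w unfolding frechet_chart_sum[OF u] by (simp add: prod_eq_iff fst_sum)
  finally show ?thesis .
qed

section \<open>The mean curvature form\<close>

lemma pd_frame:
  assumes u: "u \<in> U"
  shows "pd i (frame F j) u = pd i phase u *s torus_frame \<theta> (\<psi> u) (pd j \<psi> u)
     + phase u *s torus_frame_deriv \<theta> (\<psi> u) (pd j \<psi> u) (pd i \<psi> u) (pd i (pd j \<psi>) u)"
  using pd_eqI[OF open_U u frame_eq[of _ j] has_derivative_scale[OF has_derivative_phase[OF u]
      has_derivative_torus_frame[OF has_derivative_chart[OF u] has_derivative_pd_chart[OF u, of j]]], of i]
  by (simp add: pd_def[of i] add.commute)

lemma herm_pd_F: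
  assumes u: "u \<in> U"
  shows "herm (pd i F u) (F u) = pd i phase u * cnj (phase u) + \<i> * of_real ((sin \<theta>)\<^sup>2) * fst (pd i \<psi> u)"
proof -
  have "herm (pd i F u) (F u) = pd i phase u * cnj (phase u) * herm (torus_lift \<theta> (\<psi> u)) (torus_lift \<theta> (\<psi> u))
      + phase u * (cnj (phase u) * herm (torus_deriv \<theta> (\<psi> u) (pd i \<psi> u)) (torus_lift \<theta> (\<psi> u)))"
    unfolding pd_def[of i F] frechet_derivative_F[OF u] unfolding F_eq(1)[OF u]
    by (simp add: herm_simps pd_def algebra_simps)
  then show ?thesis
    unfolding phase_cancel[OF u] herm_self
    by (simp add: norm_torus_lift norm_snd u herm_torus_deriv_lift tangent_pd)
qed

text \<open>The derivative of the phase contributes equal terms to the two parts of the covariant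
  derivative, which cancel.  Only the derivative of the model frame and the rotation speed
  \<open>(sin \<theta>)\<^sup>2 * fst (pd i \<psi> u)\<close> of \<open>torus_lift\<close> along the fibre remain.  Eliminating
  the round metric in favour of \<open>gmat\<close> leaves a form whose trace is easy to take.\<close>

lemma kform_cov_deriv_frame:
  assumes u: "u \<in> U"
  shows "kform (cov_deriv F i (frame F j) u) (frame F k u)
    = (sin \<theta>)\<^sup>2 * (cos \<theta>)\<^sup>2 * (1 + (cos \<theta>)\<^sup>2) * (fst (pd i \<psi> u) * fst (pd j \<psi> u) * fst (pd k \<psi> u))
      - (cos \<theta>)\<^sup>2 * (fst (pd i \<psi> u) * gmat F u $ j $ k + fst (pd j \<psi> u) * gmat F u $ i $ k
          + fst (pd k \<psi> u) * gmat F u $ i $ j)"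
proof -
  let ?V = "torus_frame_deriv \<theta> (\<psi> u) (pd j \<psi> u) (pd i \<psi> u) (pd i (pd j \<psi>) u)"
  let ?E = "\<lambda>k. torus_frame \<theta> (\<psi> u) (pd k \<psi> u)"
  have "norm (F u) = 1"
    by (simp add: F_eq[OF u] norm_scale norm_torus_lift norm_snd u)
  then have "herm (frame F k u) (F u) = 0"
    unfolding frame_def hdiff_def by (rule herm_hor_left)
  then have FE: "herm (F u) (frame F k u) = 0"
    by (simp add: herm_commute[of "F u"])
  have g: "complex_of_real (gmat F u $ j $ k) = herm (?E j) (?E k)"
    by (simp add: herm_frame[OF u, symmetric] frame_eq[OF u] herm_simps mult.left_commute[of "cnj _"] phase_cancel[OF u])
  have "herm (cov_deriv F i (frame F j) u) (frame F k u)
     = herm (pd i (frame F j) u) (frame F k u) - herm (pd i F u) (F u) * herm (frame F j u) (frame F k u)"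
    by (simp add: cov_deriv_def hor_def herm_simps FE)
  also have "\<dots> = phase u * (cnj (phase u) * herm ?V (?E k))
       - \<i> * of_real ((sin \<theta>)\<^sup>2 * fst (pd i \<psi> u) * gmat F u $ j $ k)"
    unfolding herm_frame[OF u] herm_pd_F[OF u] pd_frame[OF u] unfolding frame_eq[OF u] herm_simps
    by (simp add: g algebra_simps)
  finally have "kform (cov_deriv F i (frame F j) u) (frame F k u)
     = (sin \<theta>)\<^sup>2 * fst (pd i \<psi> u) * gmat F u $ j $ k - Im (herm ?V (?E k))"
    unfolding phase_cancel[OF u] by (simp add: kform_eq_Im_herm)
  also have "\<dots> = (sin \<theta>)\<^sup>2 * (cos \<theta>)\<^sup>2 * (1 + (cos \<theta>)\<^sup>2) * (fst (pd i \<psi> u) * fst (pd j \<psi> u) * fst (pd k \<psi> u))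
      - (cos \<theta>)\<^sup>2 * (fst (pd i \<psi> u) * gmat F u $ j $ k + fst (pd j \<psi> u) * gmat F u $ i $ k
          + fst (pd k \<psi> u) * gmat F u $ i $ j)"
    unfolding Im_herm_torus_frame_deriv[OF norm_snd[OF u] tangent_pd[OF u] tangent_pd[OF u] tangent_pd[OF u] tangent_pd2[OF u]]
      gmat_eq[OF u] sin_squared_eq
    by (simp add: algebra_simps eval_nat_numeral)
  finally show ?thesis .
qed

lemma kform_diff: "kform (v - v') w = kform v w - kform v' w"
  and kform_scaleR: "kform (r *\<^sub>R v) w = r * kform v w"
  by (simp_all add: kform_eq_Im_herm herm_simps scaleR_eq_scale)

lemma kform_sum: "kform (\<Sum>i\<in>A. v i) w = (\<Sum>i\<in>A. kform (v i) w)"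
proof -
  have "herm (\<Sum>i\<in>A. v i) w = (\<Sum>i\<in>A. herm (v i) w)"
    unfolding herm_def sum_component sum_distrib_right by (rule sum.swap)
  then show ?thesis by (simp add: kform_eq_Im_herm Im_sum sum_negf)
qed

lemma kform_normal_part:
  "u \<in> U \<Longrightarrow> kform (normal_part F u v) (frame F k u) = kform v (frame F k u)"
  by (simp add: normal_part_def kform_diff kform_sum kform_scaleR)
     (simp add: kform_eq_Im_herm herm_frame)

text \<open>The normal projection drops out because tangent vectors are orthogonal under \<open>kform\<close>.  In the
  trace of the cubic form, \<open>dt\<^sup>3\<close> gives the squared length of \<open>dt\<close>, which cancels
  \<open>(sin \<theta>)\<^sup>2 * (cos \<theta>)\<^sup>2\<close>, and the symmetrised product of \<open>dt\<close> with the metric gives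
  \<open>(CARD('n) + 2) dt\<close>; so the coefficient is \<open>1 + (cos \<theta>)\<^sup>2 - (CARD('n) + 2) * (cos \<theta>)\<^sup>2\<close>.\<close>

lemma alphaH_eq:
  assumes u: "u \<in> U"
  shows "alphaH F k u = (1 - (CARD('n) + 1) * (cos \<theta>)\<^sup>2) * fst (pd k \<psi> u)"
proof -
  let ?t = "\<lambda>i. fst (pd i \<psi> u)" and ?g = "\<lambda>i j. gmat F u $ i $ j" and ?h = "\<lambda>i j. ginv F u $ i $ j"
  let ?C = "(sin \<theta>)\<^sup>2 * (cos \<theta>)\<^sup>2 * (1 + (cos \<theta>)\<^sup>2)"
  have tr: "(\<Sum>i\<in>UNIV. \<Sum>j\<in>UNIV. ?h i j * ?g i j) = CARD('n)"
  proof -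
    have "(\<Sum>j\<in>UNIV. ?h i j * ?g i j) = 1" for i
      using ginv_gmat(1)[OF u, of i i] by (simp add: gmat_sym[OF u, of i])
    then show ?thesis by simp
  qed
  have jk: "(\<Sum>i\<in>UNIV. \<Sum>j\<in>UNIV. ?h i j * (?t i * ?g j k)) = ?t k"
  proof -
    have "(\<Sum>j\<in>UNIV. ?h i j * (?t i * ?g j k)) = ?t i * (if i = k then 1 else 0)" for i
      by (simp only: ginv_gmat(1)[OF u, of i k, symmetric] sum_distrib_left mult.left_commute)
    then show ?thesis by (simp add: if_distrib[of "(*) _"] cong: if_cong)
  qed
  have ik: "(\<Sum>i\<in>UNIV. \<Sum>j\<in>UNIV. ?h i j * (?t j * ?g i k)) = ?t k"
  proof -
    have "(\<Sum>i\<in>UNIV. ?h i j * (?t j * ?g i k)) = ?t j * (if k = j then 1 else 0)" for j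
      unfolding ginv_gmat(2)[OF u, of k j, symmetric] sum_distrib_left
      by (intro sum.cong refl) (subst gmat_sym[OF u], simp add: mult_ac)
    then have "(\<Sum>j\<in>UNIV. \<Sum>i\<in>UNIV. ?h i j * (?t j * ?g i k)) = ?t k"
      by (simp add: if_distrib[of "(*) _"] cong: if_cong)
    then show ?thesis by (subst sum.swap)
  qed
  have "alphaH F k u = (\<Sum>i\<in>UNIV. \<Sum>j\<in>UNIV. ?h i j * kform (cov_deriv F i (frame F j) u) (frame F k u))"
    by (simp add: alphaH_def mean_curv_def second_ff_def kform_sum kform_scaleR kform_normal_part[OF u])
  also have "\<dots> = ?C * ?t k * (\<Sum>i\<in>UNIV. \<Sum>j\<in>UNIV. ?h i j * (?t i * ?t j))
      - (cos \<theta>)\<^sup>2 * ((\<Sum>i\<in>UNIV. \<Sum>j\<in>UNIV. ?h i j * (?t i * ?g j k)) + (\<Sum>i\<in>UNIV. \<Sum>j\<in>UNIV. ?h i j * (?t j * ?g i k))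
         + ?t k * (\<Sum>i\<in>UNIV. \<Sum>j\<in>UNIV. ?h i j * ?g i j))"
    unfolding kform_cov_deriv_frame[OF u] sum_distrib_left sum.distrib[symmetric] sum_subtractf[symmetric]
    by (intro sum.cong refl) (simp add: algebra_simps)
  also have "\<dots> = (1 - (CARD('n) + 1) * (cos \<theta>)\<^sup>2) * ?t k"
    unfolding norm_sq_fst_pd[OF u] jk ik tr using trig_pos by (simp add: field_simps)
  finally show ?thesis .
qed

section \<open>The axial coordinate is harmonic\<close>

lemma pd_gmat:
  assumes u: "u \<in> U"
  shows "pd l (\<lambda>w. gmat F w $ i $ j) u
    = (sin \<theta>)\<^sup>2 * (cos \<theta>)\<^sup>2 * (fst (pd l (pd i \<psi>) u) * fst (pd j \<psi> u) + fst (pd i \<psi> u) * fst (pd l (pd j \<psi>) u))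
      + (sin \<theta>)\<^sup>2 * (snd (pd l (pd i \<psi>) u) \<bullet> snd (pd j \<psi> u) + snd (pd i \<psi> u) \<bullet> snd (pd l (pd j \<psi>) u))"
  using pd_eqI[OF open_U u gmat_eq[of _ i j] has_derivative_add[OF
        has_derivative_mult_right[OF has_derivative_mult[OF has_derivative_fst[OF has_derivative_pd_chart[OF u]]
          has_derivative_fst[OF has_derivative_pd_chart[OF u]]]]
        has_derivative_mult_right[OF has_derivative_inner[OF has_derivative_snd[OF has_derivative_pd_chart[OF u]]
          has_derivative_snd[OF has_derivative_pd_chart[OF u]]]]], of l]
  by (simp add: pd_def[of l] algebra_simps)

text \<open>By the symmetry of second derivatives the Christoffel symbols of the first kind are the
  products of the second and first derivatives of \<open>\<psi>\<close>; contracting with the gradient of the axial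
  coordinate, which is proportional to the axial vector, leaves the second derivative of that
  coordinate.  Thus its Hessian vanishes.\<close>

lemma christoffel_axial:
  assumes u: "u \<in> U"
  shows "(\<Sum>k\<in>UNIV. christoffel F k i j u * fst (pd k \<psi> u)) = fst (pd i (pd j \<psi>) u)"
proof -
  obtain w where w: "frechet_derivative \<psi> (at u) w = (1, 0)" using axial_vector[OF u] .
  define A where "A l = pd i (\<lambda>w. gmat F w $ j $ l) u + pd j (\<lambda>w. gmat F w $ i $ l) u
      - pd l (\<lambda>w. gmat F w $ i $ j) u" for l
  let ?B = "pd i (pd j \<psi>) u" and ?s = "(sin \<theta>)\<^sup>2 * (cos \<theta>)\<^sup>2"
  have A: "A l = 2 * (?s * fst ?B) * fst (pd l \<psi> u) + 2 * (sin \<theta>)\<^sup>2 * (snd ?B \<bullet> snd (pd l \<psi> u))" for l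
    unfolding A_def pd_gmat[OF u] pd_commute[OF open_U u Ck_chart, of l] pd_commute[OF open_U u Ck_chart, of j i]
    by (simp add: algebra_simps inner_commute)
  have "(\<Sum>k\<in>UNIV. christoffel F k i j u * fst (pd k \<psi> u))
     = (\<Sum>k\<in>UNIV. \<Sum>l\<in>UNIV. (1/2) * (fst (pd k \<psi> u) * ginv F u $ k $ l * A l))"
    unfolding christoffel_def A_def[symmetric] sum_distrib_left sum_distrib_right by (simp add: mult_ac)
  also have "\<dots> = (\<Sum>l\<in>UNIV. \<Sum>k\<in>UNIV. (1/2) * (fst (pd k \<psi> u) * ginv F u $ k $ l * A l))"
    by (rule sum.swap)
  also have "\<dots> = (\<Sum>l\<in>UNIV. (1/2) * ((w $ l / ?s) * A l))"
    unfolding ginv_fst_pd[OF u w, symmetric] sum_distrib_left sum_distrib_right ..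
  also have "\<dots> = fst ?B * (\<Sum>l\<in>UNIV. w $ l * fst (pd l \<psi> u))
      + (1 / (cos \<theta>)\<^sup>2) * (snd ?B \<bullet> (\<Sum>l\<in>UNIV. w $ l *\<^sub>R snd (pd l \<psi> u)))"
    unfolding sum_distrib_left inner_sum_right sum.distrib[symmetric] A
    using trig_pos by (intro sum.cong refl) (simp add: field_simps)
  also have "(\<Sum>l\<in>UNIV. w $ l * fst (pd l \<psi> u)) = 1"
    using w unfolding frechet_chart_sum[OF u] by (simp add: prod_eq_iff fst_sum)
  also have "(\<Sum>l\<in>UNIV. w $ l *\<^sub>R snd (pd l \<psi> u)) = 0"
    using w unfolding frechet_chart_sum[OF u] by (simp add: prod_eq_iff snd_sum)
  finally show ?thesis by simp
qed

lemma codiff_alphaH: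
  assumes u: "u \<in> U"
  shows "codiff F (alphaH F) u = 0"
proof -
  let ?K = "1 - (CARD('n) + 1) * (cos \<theta>)\<^sup>2"
  have "pd i (alphaH F j) u = ?K * fst (pd i (pd j \<psi>) u)" for i j
    using pd_eqI[OF open_U u alphaH_eq[of _ j] has_derivative_mult_right[OF has_derivative_fst[OF has_derivative_pd_chart[OF u]]], of i]
    by (simp add: pd_def[of i])
  moreover have "(\<Sum>k\<in>UNIV. christoffel F k i j u * alphaH F k u) = ?K * fst (pd i (pd j \<psi>) u)" for i j
    unfolding christoffel_axial[OF u, symmetric] alphaH_eq[OF u] sum_distrib_left by (simp add: mult_ac)
  ultimately show ?thesis by (simp add: codiff_def)
qed

lemma inj_hdiff:
  assumes u: "u \<in> U"
  shows "inj (hdiff F u)"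
proof (rule injI)
  fix v w assume eq: "hdiff F u v = hdiff F u w"
  have lin: "linear (frechet_derivative \<psi> (at u))"
    using has_derivative_chart[OF u] has_derivative_linear by blast
  let ?D = "frechet_derivative \<psi> (at u) (v - w)"
  have "linear (frechet_derivative F (at u))"
    using Ck_on_differentiable[OF open_U Ck_F[of "Suc 0"] u] has_derivative_linear by blast
  then have "hdiff F u (v - w) = hdiff F u v - hdiff F u w"
    by (simp add: hdiff_def hor_def linear_diff herm_simps vec_eq_iff algebra_simps)
  then have "hdiff F u (v - w) = 0" using eq by simp
  then have "herm (hdiff F u (v - w)) (hdiff F u (v - w)) = 0" by (simp add: herm_self)
  then have "(sin \<theta>)\<^sup>2 * (cos \<theta>)\<^sup>2 * (fst ?D * fst ?D) + (sin \<theta>)\<^sup>2 * (norm (snd ?D))\<^sup>2 = 0"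
    unfolding herm_hdiff[OF u] of_real_eq_0_iff power2_norm_eq_inner .
  then have "?D = 0" using trig_pos by (auto simp: add_nonneg_eq_0_iff prod_eq_iff)
  then show "v = w" using inj_chart[OF u] linear_injective_0[OF lin] by auto
qed

lemma kform_hdiff: "u \<in> U \<Longrightarrow> kform (hdiff F u v) (hdiff F u w) = 0"
  by (simp add: kform_eq_Im_herm herm_hdiff)

lemma mean_curv_nonzero:
  assumes u: "u \<in> U" and "(CARD('n) + 1) * (cos \<theta>)\<^sup>2 \<noteq> 1"
  shows "mean_curv F u \<noteq> 0"
proof
  assume "mean_curv F u = 0"
  then have "alphaH F k u = 0" for k by (simp add: alphaH_def kform_def)
  then have "fst (pd k \<psi> u) = 0" for k
    using alphaH_eq[OF u, of k] assms(2) by simp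
  moreover obtain w where "frechet_derivative \<psi> (at u) w = (1, 0)" using axial_vector[OF u] .
  ultimately show False unfolding frechet_chart_sum[OF u] by (simp add: prod_eq_iff fst_sum)
qed

end

section \<open>A global chart of the cylinder\<close>

text \<open>Polar coordinates identify the punctured space with the cylinder, so one chart suffices in
  every dimension, including the disconnected case \<open>CARD('n) = 1\<close>.\<close>

definition polar_chart :: "real^'n::finite \<Rightarrow> real \<times> (real^'n)" where
  "polar_chart u = (ln (norm u), inverse (norm u) *\<^sub>R u)"

definition polar_deriv :: "real^'n::finite \<Rightarrow> real^'n \<Rightarrow> real \<times> (real^'n)" where
  "polar_deriv u v = ((u \<bullet> v) / (norm u)\<^sup>2, inverse (norm u) *\<^sub>R v - ((u \<bullet> v) / (norm u)^3) *\<^sub>R u)"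

lemma has_derivative_polar:
  assumes "u \<noteq> 0"
  shows "(polar_chart has_derivative polar_deriv u) (at u)"
proof -
  have "((\<lambda>u. ln (norm u)) has_derivative (\<lambda>v. (u \<bullet> v) / (norm u)\<^sup>2)) (at u)"
    using assms by (auto intro!: derivative_eq_intros has_derivative_norm_at simp: power2_eq_square field_simps)
  moreover have "((\<lambda>u. inverse (norm u) *\<^sub>R u) has_derivative
      (\<lambda>v. inverse (norm u) *\<^sub>R v - ((u \<bullet> v) / (norm u)^3) *\<^sub>R u)) (at u)"
    using assms by (auto intro!: derivative_eq_intros has_derivative_norm_at simp: power3_eq_cube field_simps)
  ultimately show ?thesis
    unfolding polar_chart_def polar_deriv_def by (rule has_derivative_Pair)
qed

lemma frechet_polar: "u \<noteq> 0 \<Longrightarrow> frechet_derivative polar_chart (at u) = polar_deriv u"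
  using frechet_derivative_at[OF has_derivative_polar] by metis

lemma norm_polar_deriv:
  assumes "u \<noteq> 0"
  shows "norm (polar_deriv u v) \<le> 3 * norm v / norm u"
proof -
  have cs: "\<bar>u \<bullet> v\<bar> \<le> norm u * norm v" by (rule Cauchy_Schwarz_ineq2)
  have "norm (polar_deriv u v) \<le> \<bar>u \<bullet> v\<bar> / (norm u)\<^sup>2 + (norm v / norm u + \<bar>u \<bullet> v\<bar> / (norm u)^3 * norm u)"
    unfolding polar_deriv_def
    using norm_triangle_ineq4[of "inverse (norm u) *\<^sub>R v" "((u \<bullet> v) / (norm u)^3) *\<^sub>R u"]
    by (intro norm_Pair_le[THEN order_trans] add_mono) (simp_all add: divide_inverse abs_mult mult.commute power_abs)
  also have "\<dots> \<le> (norm u * norm v) / (norm u)\<^sup>2 + (norm v / norm u + (norm u * norm v) / (norm u)^3 * norm u)"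
    using cs by (intro add_mono divide_right_mono mult_right_mono order_refl) auto
  also have "\<dots> = 3 * norm v / norm u"
    using assms by (simp add: power2_eq_square power3_eq_cube field_simps)
  finally show ?thesis .
qed

lemma inj_polar_deriv:
  assumes "u \<noteq> 0"
  shows "inj (polar_deriv u)"
proof -
  have "linear (polar_deriv u)" using has_derivative_polar[OF assms] has_derivative_linear by blast
  moreover have "v = 0" if "polar_deriv u v = 0" for v
    using that assms by (auto simp: polar_deriv_def zero_prod_def)
  ultimately show ?thesis using linear_injective_0 by blast
qed

lemma polar_chart_exp: "norm (snd p) = 1 \<Longrightarrow> polar_chart (exp (fst p) *\<^sub>R snd p) = p"
  by (simp add: polar_chart_def prod_eq_iff)

lemma polar_image: "polar_chart ` (UNIV - {0}) = cylinder"
proof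
  show "polar_chart ` (UNIV - {0}) \<subseteq> cylinder"
    by (auto simp: polar_chart_def cylinder_def)
  show "cylinder \<subseteq> polar_chart ` (UNIV - {0})"
  proof
    fix p :: "real \<times> (real^'n)" assume "p \<in> cylinder"
    then have "norm (snd p) = 1" by (auto simp: cylinder_def)
    then show "p \<in> polar_chart ` (UNIV - {0})"
      by (intro image_eqI[where x = "exp (fst p) *\<^sub>R snd p"]) (auto simp: polar_chart_exp)
  qed
qed

lemma inj_on_polar: "inj_on polar_chart (UNIV - {0})"
  by (auto simp: inj_on_def polar_chart_def)

lemma Ck_on_polar: "Ck_on k polar_chart (UNIV - {0})"
proof -
  have "Ck_on k (\<lambda>u. (ln (norm u), 0) + (0, inverse (norm u) *\<^sub>R u)) (UNIV - {0 :: real^'n})"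
    by (intro Ck_on_add open_punctured Ck_on_linear_compose[OF _ open_punctured Ck_on_ln_norm]
        Ck_on_linear_compose[where L = "Pair 0", OF _ open_punctured Ck_on_bilinear[OF bounded_bilinear_scaleR open_punctured
            Ck_on_inverse_norm Ck_on_bounded_linear[OF open_punctured bounded_linear_ident]]]
        bounded_linear_Pair bounded_linear_zero bounded_linear_ident)
  then show ?thesis by (simp add: polar_chart_def[abs_def])
qed

lemma local_param_polar: "local_param polar_chart (UNIV - {0 :: real^'n::finite})"
  unfolding local_param_def smooth_on_def
  using open_punctured Ck_on_polar inj_on_polar polar_image
  by (auto simp: frechet_polar inj_polar_deriv)

lemma Ck_on_torus_lift_polar:
  "Ck_on k (\<lambda>u. torus_lift \<theta> (polar_chart u)) (UNIV - {0 :: real^'n::finite})"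
proof -
  have bil: "bounded_bilinear (\<lambda>(c::complex) (y::real^'n). join 0 (c *s cvec y))"
    unfolding bilinear_conv_bounded_bilinear[symmetric] bilinear_def linear_iff
    by (auto simp: vec_eq_iff join_def algebra_simps complex_eq_iff split: option.split)
  have "Ck_on k (\<lambda>u. join (complex_of_real (cos \<theta>)) 0 + join 0 ((of_real (sin \<theta>) * exp (\<i> * of_real (ln (norm u))))
      *s cvec (inverse (norm u) *\<^sub>R u))) (UNIV - {0 :: real^'n})"
    by (intro Ck_on_add open_punctured Ck_on_const Ck_on_bilinear[OF bil] Ck_on_bilinear[OF bounded_bilinear_mult]
         Ck_on_exp Ck_on_bilinear[OF bounded_bilinear_scaleR] Ck_on_inverse_norm
         Ck_on_bounded_linear[OF open_punctured bounded_linear_ident]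
         Ck_on_linear_compose[OF bounded_linear_of_real open_punctured Ck_on_ln_norm])
  moreover have "join (complex_of_real (cos \<theta>)) 0 + join 0 ((of_real (sin \<theta>) * exp (\<i> * of_real (ln (norm u))))
      *s cvec (inverse (norm u) *\<^sub>R u)) = torus_lift \<theta> (polar_chart u)" for u :: "real^'n"
    by (simp add: torus_lift_def polar_chart_def join_add cis_conv_exp)
  ultimately show ?thesis by simp
qed

lemma norm_snd_polar: "u \<noteq> 0 \<Longrightarrow> norm (snd (polar_chart u)) = 1"
  by (simp add: polar_chart_def)

lemma coord_lift_polar:
  "coord_lift (torus_map \<theta>) polar_chart (UNIV - {0}) (\<lambda>u. torus_lift \<theta> (polar_chart u))"
  unfolding coord_lift_def smooth_on_def
  using local_param_polar Ck_on_torus_lift_polar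
  by (auto simp: norm_torus_lift norm_snd_polar torus_map_def)

section \<open>Lagrangian and Hamiltonian minimal, but not minimal\<close>

lemma lagrangian_torus_map:
  assumes "0 < \<theta>" "\<theta> < pi / 2"
  shows "lagrangian_immersion (torus_map \<theta>)"
  unfolding lagrangian_immersion_def smooth_map_def
proof (intro conjI ballI allI impI)
  fix p :: "real \<times> (real^'n)" assume "p \<in> cylinder"
  then show "\<exists>\<psi> U F. coord_lift (torus_map \<theta>) \<psi> U F \<and> p \<in> \<psi> ` U"
    using coord_lift_polar polar_image by metis
next
  fix \<psi> U F u v w assume "coord_lift (torus_map \<theta>) \<psi> U F" and u: "u \<in> U"
  then interpret torus_coord_lift \<theta> \<psi> U F using assms by unfold_locales
  show "inj (hdiff F u)" "kform (hdiff F u v) (hdiff F u w) = 0"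
    using inj_hdiff kform_hdiff u by auto
qed

lemma H_minimal_torus_map:
  assumes "0 < \<theta>" "\<theta> < pi / 2"
  shows "H_minimal (torus_map \<theta>)"
  unfolding H_minimal_def
  using torus_coord_lift.codiff_alphaH[OF torus_coord_lift.intro[OF assms]] by blast

lemma not_minimal_torus_map:
  assumes "0 < \<theta>" "\<theta> < pi / 2" "(CARD('n) + 1) * (cos \<theta>)\<^sup>2 \<noteq> 1"
  shows "\<not> minimal (torus_map \<theta> :: real \<times> (real^'n::finite) \<Rightarrow> _)"
proof
  assume "minimal (torus_map \<theta> :: real \<times> (real^'n) \<Rightarrow> _)"
  moreover have "(axis undefined 1 :: real^'n) \<in> UNIV - {0}" by (simp add: axis_eq_0_iff)
  ultimately show False
    using torus_coord_lift.mean_curv_nonzero[OF torus_coord_lift.intro[OF assms(1,2) coord_lift_polar] _ assms(3)]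
      coord_lift_polar unfolding minimal_def by metis
qed

section \<open>Completeness\<close>

text \<open>The speed of a lifted curve is that of its projection in the product metric.  The identity is
  derived for one-sided derivatives, since at the end points of the interval
  \<open>c\<close> and \<open>\<sigma>\<close> are related on one side only.\<close>

lemma norm_hor_curve:
  fixes c :: "real \<Rightarrow> real \<times> (real^'n::finite)"
  assumes \<theta>: "0 < \<theta>" "\<theta> < pi / 2"
    and rel: "\<And>s. s \<in> {0..1} \<Longrightarrow> c s \<in> cylinder \<and> norm (\<sigma> s) = 1 \<and> hopf (\<sigma> s) = torus_map \<theta> (c s)"
    and s: "s \<in> {0..1}"
    and c': "(c has_vector_derivative c') (at s)" and \<sigma>': "(\<sigma> has_vector_derivative \<sigma>') (at s)"
  shows "(norm (hor (\<sigma> s) \<sigma>'))\<^sup>2 = (sin \<theta>)\<^sup>2 * (cos \<theta>)\<^sup>2 * (fst c')\<^sup>2 + (sin \<theta>)\<^sup>2 * (norm (snd c'))\<^sup>2"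
proof -
  have cos: "cos \<theta> > 0" using \<theta> by (simp add: cos_gt_zero)
  have D: "(c has_derivative (\<lambda>h. h *\<^sub>R c')) (at s within {0..1})"
      "(\<sigma> has_derivative (\<lambda>h. h *\<^sub>R \<sigma>')) (at s within {0..1})"
    using c' \<sigma>' unfolding has_vector_derivative_def by (auto intro: has_derivative_at_withinI)
  have unique: "f' = g'" if "(f has_derivative f') (at s within {0..1})" "(f has_derivative g') (at s within {0..1})"
    for f :: "real \<Rightarrow> 'b::euclidean_space" and f' g'
    using frechet_derivative_unique_within_closed_interval[of 0 1 s f f' g'] that s by simp
  have nrm: "norm (snd (c s)) = 1" if "s \<in> {0..1}" for s
    using rel[OF that] by (auto simp: cylinder_def)
  have tan: "snd (c s) \<bullet> snd c' = 0"
  proof -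
    have 1: "((\<lambda>s. snd (c s) \<bullet> snd (c s)) has_derivative (\<lambda>h. 2 * h * (snd (c s) \<bullet> snd c'))) (at s within {0..1})"
      using has_derivative_inner[OF has_derivative_snd[OF D(1)] has_derivative_snd[OF D(1)]]
      by (simp add: inner_commute mult.assoc)
    have 2: "((\<lambda>s. snd (c s) \<bullet> snd (c s)) has_derivative (\<lambda>h. 0)) (at s within {0..1})"
      by (rule has_derivative_transform[OF s _ has_derivative_const[of 1]]) (simp add: dot_square_norm nrm)
    from fun_cong[OF unique[OF 1 2], of 1] show ?thesis by simp
  qed
  define \<gamma> where "\<gamma> s = \<sigma> s $ None / of_real (cos \<theta>)" for s
  have \<sigma>: "\<sigma> s = \<gamma> s *s torus_lift \<theta> (c s)" "cmod (\<gamma> s) = 1" if t: "s \<in> {0..1}" for s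
  proof -
    obtain a where a: "cmod a = 1" "\<sigma> s = a *s torus_lift \<theta> (c s)"
      using rel[OF t] hopf_eq_iff norm_torus_lift[OF nrm[OF t]] unfolding torus_map_def by blast
    then have "\<gamma> s = a" using cos by (simp add: \<gamma>_def torus_lift_def)
    with a show "\<sigma> s = \<gamma> s *s torus_lift \<theta> (c s)" "cmod (\<gamma> s) = 1" by auto
  qed
  define \<gamma>' where "\<gamma>' = \<sigma>' $ None / of_real (cos \<theta>)"
  have \<gamma>: "(\<gamma> has_derivative (\<lambda>h. h *\<^sub>R \<gamma>')) (at s within {0..1})"
    using has_derivative_mult_left[OF bounded_linear.has_derivative[OF bounded_linear_vec_nth[of None] D(2)], of "1 / of_real (cos \<theta>)"]
    unfolding \<gamma>_def \<gamma>'_def by (simp add: divide_inverse)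
  have "(\<sigma> has_derivative (\<lambda>h. \<gamma> s *s torus_deriv \<theta> (c s) (h *\<^sub>R c') + (h *\<^sub>R \<gamma>') *s torus_lift \<theta> (c s))) (at s within {0..1})"
    by (rule has_derivative_transform[OF s _ has_derivative_scale[OF \<gamma> has_derivative_torus_lift[OF D(1)]]]) (simp add: \<sigma>)
  from fun_cong[OF unique[OF D(2) this], of 1]
  have "\<sigma>' = \<gamma>' *s torus_lift \<theta> (c s) + \<gamma> s *s torus_deriv \<theta> (c s) c'" by simp
  then have hor: "hor (\<sigma> s) \<sigma>' = \<gamma> s *s torus_frame \<theta> (c s) c'"
    using \<sigma>[OF s] hor_phase norm_torus_lift[OF nrm[OF s]] hor_torus_deriv[OF nrm[OF s] tan] by metis
  have "complex_of_real ((norm (torus_frame \<theta> (c s) c'))\<^sup>2)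
      = complex_of_real ((sin \<theta>)\<^sup>2 * (cos \<theta>)\<^sup>2 * (fst c')\<^sup>2 + (sin \<theta>)\<^sup>2 * (norm (snd c'))\<^sup>2)"
    unfolding herm_self[symmetric] herm_torus_frame[OF nrm[OF s] tan tan]
    by (simp add: power2_eq_square dot_square_norm)
  then show ?thesis unfolding hor of_real_eq_iff by (simp add: norm_scale \<sigma>[OF s])
qed

lemma norm_hor_curve_bounds:
  fixes c :: "real \<Rightarrow> real \<times> (real^'n::finite)"
  assumes \<theta>: "0 < \<theta>" "\<theta> < pi / 2"
    and rel: "\<And>s. s \<in> {0..1} \<Longrightarrow> c s \<in> cylinder \<and> norm (\<sigma> s) = 1 \<and> hopf (\<sigma> s) = torus_map \<theta> (c s)"
    and s: "s \<in> {0..1}"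
    and c': "(c has_vector_derivative c') (at s)" and \<sigma>': "(\<sigma> has_vector_derivative \<sigma>') (at s)"
  shows "sin \<theta> * cos \<theta> * norm c' \<le> norm (hor (\<sigma> s) \<sigma>')" and "norm (hor (\<sigma> s) \<sigma>') \<le> norm c'"
proof -
  have trig: "0 < sin \<theta>" "0 < cos \<theta>" using \<theta> by (auto intro: cos_gt_zero sin_gt_zero2)
  have speed: "(norm (hor (\<sigma> s) \<sigma>'))\<^sup>2
      = (sin \<theta>)\<^sup>2 * (cos \<theta>)\<^sup>2 * (fst c')\<^sup>2 + (sin \<theta>)\<^sup>2 * (norm (snd c'))\<^sup>2"
    by (rule norm_hor_curve[OF assms])
  have le1: "(sin \<theta>)\<^sup>2 \<le> 1" "(cos \<theta>)\<^sup>2 \<le> 1" by (simp_all add: power_le_one abs_square_le_1)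
  have nc: "(norm c')\<^sup>2 = (fst c')\<^sup>2 + (norm (snd c'))\<^sup>2"
    by (simp add: norm_prod_def)
  have "(sin \<theta> * cos \<theta> * norm c')\<^sup>2
      = (sin \<theta>)\<^sup>2 * (cos \<theta>)\<^sup>2 * (fst c')\<^sup>2 + (sin \<theta>)\<^sup>2 * (cos \<theta>)\<^sup>2 * (norm (snd c'))\<^sup>2"
    by (simp add: power_mult_distrib nc distrib_left)
  also have "\<dots> \<le> (norm (hor (\<sigma> s) \<sigma>'))\<^sup>2"
    unfolding speed
    using le1 by (intro add_left_mono mult_right_mono mult_left_le) auto
  finally have "(sin \<theta> * cos \<theta> * norm c')\<^sup>2 \<le> (norm (hor (\<sigma> s) \<sigma>'))\<^sup>2" .
  then show "sin \<theta> * cos \<theta> * norm c' \<le> norm (hor (\<sigma> s) \<sigma>')"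
    using power2_le_imp_le norm_ge_zero by blast
  have "(norm (hor (\<sigma> s) \<sigma>'))\<^sup>2 \<le> (norm c')\<^sup>2"
    unfolding speed nc
    using le1 by (intro add_mono mult_left_le_one_le mult_le_one) auto
  then show "norm (hor (\<sigma> s) \<sigma>') \<le> norm c'"
    using power2_le_imp_le norm_ge_zero by blast
qed

lemma integrable_speed:
  fixes \<sigma> :: "real \<Rightarrow> complex^'m::finite"
  assumes "\<sigma> C1_differentiable_on {0..1}"
  shows "(\<lambda>s. norm (hor (\<sigma> s) (vector_derivative \<sigma> (at s)))) integrable_on {0..1}"
proof (rule integrable_continuous_interval)
  have "continuous_on {0..1} (\<lambda>s. vector_derivative \<sigma> (at s))"
    using assms unfolding C1_differentiable_on_eq by blast
  moreover have "continuous_on {0..1} \<sigma>"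
    using assms C1_differentiable_imp_continuous_on by blast
  ultimately show "continuous_on {0..1} (\<lambda>s. norm (hor (\<sigma> s) (vector_derivative \<sigma> (at s))))"
    unfolding hor_def herm_def
    by (intro continuous_intros bounded_bilinear.continuous_on[OF bounded_bilinear_scale])
qed

lemma C1_has_vector_derivative:
  "f C1_differentiable_on S \<Longrightarrow> s \<in> S \<Longrightarrow> (f has_vector_derivative vector_derivative f (at s)) (at s)"
  unfolding C1_differentiable_on_eq using vector_derivative_works by blast

lemma induced_dist_lower:
  assumes \<theta>: "0 < \<theta>" "\<theta> < pi / 2"
  shows "ereal (sin \<theta> * cos \<theta> * norm (q - p)) \<le> induced_dist (torus_map \<theta>) p q"
  unfolding induced_dist_def
proof (rule Inf_greatest, safe)
  fix c \<sigma>
  assume c: "c C1_differentiable_on {0..1}" and \<sigma>: "\<sigma> C1_differentiable_on {0..1}"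
    and rel: "\<forall>s\<in>{0..1}. c s \<in> cylinder \<and> norm (\<sigma> s) = 1 \<and> hopf (\<sigma> s) = torus_map \<theta> (c s)"
  have trig: "0 < sin \<theta>" "0 < cos \<theta>" using \<theta> by (auto intro: cos_gt_zero sin_gt_zero2)
  have "((\<lambda>s. vector_derivative c (at s)) has_integral (c 1 - c 0)) {0..1}"
    by (rule fundamental_theorem_of_calculus)
       (auto intro!: has_vector_derivative_at_within[OF C1_has_vector_derivative[OF c]])
  then have I: "((\<lambda>s. (sin \<theta> * cos \<theta>) *\<^sub>R vector_derivative c (at s)) has_integral (sin \<theta> * cos \<theta>) *\<^sub>R (c 1 - c 0)) {0..1}"
    by (rule has_integral_cmul)
  have "norm (integral {0..1} (\<lambda>s. (sin \<theta> * cos \<theta>) *\<^sub>R vector_derivative c (at s)))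
      \<le> integral {0..1} (\<lambda>s. norm (hor (\<sigma> s) (vector_derivative \<sigma> (at s))))"
    using norm_hor_curve_bounds(1)[OF \<theta> _ _ C1_has_vector_derivative[OF c] C1_has_vector_derivative[OF \<sigma>]] rel trig
    by (intro integral_norm_bound_integral has_integral_integrable[OF I] integrable_speed[OF \<sigma>]) auto
  then show "ereal (sin \<theta> * cos \<theta> * norm (c 1 - c 0)) \<le> ereal (integral {0..1} (\<lambda>s. norm (hor (\<sigma> s) (vector_derivative \<sigma> (at s)))))"
    using trig unfolding integral_unique[OF I] by simp
qed

lemma C1_along_line:
  assumes "open U" "Ck_on (Suc 0) f U" and "\<And>s. s \<in> {0..1} \<Longrightarrow> u + s *\<^sub>R d \<in> U"
  shows "(\<lambda>s. f (u + s *\<^sub>R d)) C1_differentiable_on {0..1}"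
    and "s \<in> {0..1} \<Longrightarrow> ((\<lambda>s. f (u + s *\<^sub>R d)) has_vector_derivative frechet_derivative f (at (u + s *\<^sub>R d)) d) (at s)"
proof -
  have D: "((\<lambda>s. f (u + s *\<^sub>R d)) has_vector_derivative frechet_derivative f (at (u + s *\<^sub>R d)) d) (at s)"
    if "s \<in> {0..1}" for s
  proof -
    have "((\<lambda>s. u + s *\<^sub>R d) has_derivative (\<lambda>h. h *\<^sub>R d)) (at s)"
      by (auto intro!: derivative_eq_intros)
    from has_derivative_compose[where g = f, OF this Ck_on_differentiable[OF assms(1,2) assms(3)[OF that]]]
    show ?thesis
      using linear_cmul[OF has_derivative_linear[OF Ck_on_differentiable[OF assms(1,2) assms(3)[OF that]]]]
      by (simp add: has_vector_derivative_def)
  qed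
  then show "s \<in> {0..1} \<Longrightarrow> ((\<lambda>s. f (u + s *\<^sub>R d)) has_vector_derivative frechet_derivative f (at (u + s *\<^sub>R d)) d) (at s)" .
  have "continuous_on U (\<lambda>x. frechet_derivative f (at x) d)" using assms(2) by simp
  then have "continuous_on {0..1} (\<lambda>s. frechet_derivative f (at (u + s *\<^sub>R d)) d)"
    by (rule continuous_on_compose2) (use assms(3) in \<open>auto intro!: continuous_intros\<close>)
  then show "(\<lambda>s. f (u + s *\<^sub>R d)) C1_differentiable_on {0..1}"
    unfolding C1_differentiable_on_def
    by (intro exI[of _ "\<lambda>s. frechet_derivative f (at (u + s *\<^sub>R d)) d"] conjI ballI D)
qed

text \<open>The segment from \<open>v\<close> to \<open>u\<close> stays at distance at least \<open>norm u / 2\<close> from the origin, where by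
  \<open>norm_polar_deriv\<close> the chart stretches lengths by at most \<open>3 / (norm u / 2)\<close>.\<close>

lemma induced_dist_upper:
  assumes \<theta>: "0 < \<theta>" "\<theta> < pi / 2" and u: "u \<noteq> 0" and v: "norm (v - u) \<le> norm u / 2"
  shows "induced_dist (torus_map \<theta>) (polar_chart v) (polar_chart u) \<le> ereal (6 * norm (v - u) / norm u)"
proof -
  let ?l = "\<lambda>s. v + s *\<^sub>R (u - v)"
  have far: "norm u / 2 \<le> norm (?l s)" if "s \<in> {0..1}" for s
  proof -
    have "norm u \<le> norm (?l s) + norm ((1 - s) *\<^sub>R (u - v))"
      using norm_triangle_ineq[of "?l s" "(1 - s) *\<^sub>R (u - v)"] by (simp add: algebra_simps)
    also have "norm ((1 - s) *\<^sub>R (u - v)) \<le> 1 * norm (v - u)"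
      unfolding norm_scaleR using that by (intro mult_mono) (auto simp: norm_minus_commute)
    finally show ?thesis using v by simp
  qed
  then have nz: "?l s \<in> UNIV - {0}" if "s \<in> {0..1}" for s
    using u that by force
  define c where "c s = polar_chart (?l s)" for s
  define \<sigma> where "\<sigma> s = torus_lift \<theta> (c s)" for s
  have C: "c C1_differentiable_on {0..1}"
    "\<And>s. s \<in> {0..1} \<Longrightarrow> (c has_vector_derivative frechet_derivative polar_chart (at (?l s)) (u - v)) (at s)"
    unfolding c_def using C1_along_line[OF open_punctured Ck_on_polar nz] by blast+
  have S: "\<sigma> C1_differentiable_on {0..1}"
    unfolding \<sigma>_def c_def using C1_along_line(1)[OF open_punctured Ck_on_torus_lift_polar nz] by blast
  have rel: "c s \<in> cylinder \<and> norm (\<sigma> s) = 1 \<and> hopf (\<sigma> s) = torus_map \<theta> (c s)" if "s \<in> {0..1}" for s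
    using nz[OF that] polar_image unfolding \<sigma>_def c_def
    by (auto simp: torus_map_def norm_torus_lift norm_snd_polar)
  have "norm (hor (\<sigma> s) (vector_derivative \<sigma> (at s))) \<le> 6 * norm (v - u) / norm u" if s: "s \<in> {0..1}" for s
  proof -
    have "norm (hor (\<sigma> s) (vector_derivative \<sigma> (at s))) \<le> norm (polar_deriv (?l s) (u - v))"
      using norm_hor_curve_bounds(2)[OF \<theta> rel s C(2)[OF s] C1_has_vector_derivative[OF S s]] nz[OF s]
      by (simp add: frechet_polar)
    also have "\<dots> \<le> 3 * norm (u - v) / norm (?l s)"
      using nz[OF s] by (intro norm_polar_deriv) auto
    also have "\<dots> \<le> 3 * norm (u - v) / (norm u / 2)"
      using far[OF s] u by (intro divide_left_mono mult_pos_pos) (auto intro: less_le_trans[of 0 "norm u / 2"])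
    finally show ?thesis by (simp add: norm_minus_commute)
  qed
  then have "integral {0..1} (\<lambda>s. norm (hor (\<sigma> s) (vector_derivative \<sigma> (at s)))) \<le> integral {0..1} (\<lambda>s::real. 6 * norm (v - u) / norm u)"
    by (intro integral_le integrable_speed S) auto
  then have "integral {0..1} (\<lambda>s. norm (hor (\<sigma> s) (vector_derivative \<sigma> (at s)))) \<le> 6 * norm (v - u) / norm u"
    by simp
  moreover have "induced_dist (torus_map \<theta>) (polar_chart v) (polar_chart u)
     \<le> ereal (integral {0..1} (\<lambda>s. norm (hor (\<sigma> s) (vector_derivative \<sigma> (at s)))))"
    unfolding induced_dist_def
    by (rule Inf_lower, rule CollectI, intro exI[of _ c] exI[of _ \<sigma>])
       (use C(1) S rel in \<open>auto simp: c_def\<close>)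
  ultimately show ?thesis by (meson ereal_less_eq(3) order_trans)
qed

text \<open>A Cauchy sequence of the induced distance is a Cauchy sequence of the Euclidean distance, whose
  limit lies in the closed cylinder; pulling the sequence back to the punctured space shows that it
  also converges in the induced distance.\<close>

lemma complete_torus_map:
  assumes \<theta>: "0 < \<theta>" "\<theta> < pi / 2"
  shows "complete_immersion (torus_map \<theta> :: real \<times> (real^'n::finite) \<Rightarrow> _)"
  unfolding complete_immersion_def
proof (intro allI impI, elim conjE)
  fix x :: "nat \<Rightarrow> real \<times> (real^'n)"
  assume cyl: "\<forall>k. x k \<in> cylinder"
    and cauchy: "\<forall>e>0. \<exists>N. \<forall>j\<ge>N. \<forall>k\<ge>N. induced_dist (torus_map \<theta>) (x j) (x k) < e"
  have trig: "0 < sin \<theta> * cos \<theta>" using \<theta> by (intro mult_pos_pos cos_gt_zero sin_gt_zero2)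
  have "Cauchy x"
  proof (rule CauchyI)
    fix e :: real assume "e > 0"
    then have "ereal (sin \<theta> * cos \<theta> * e) > 0" using trig by simp
    then obtain N where N: "\<And>j k. j \<ge> N \<Longrightarrow> k \<ge> N \<Longrightarrow> induced_dist (torus_map \<theta>) (x j) (x k) < ereal (sin \<theta> * cos \<theta> * e)"
      using cauchy by meson
    have "norm (x m - x n) < e" if "m \<ge> N" "n \<ge> N" for m n
      using le_less_trans[OF induced_dist_lower[OF \<theta>] N[OF that(2,1)]] mult_less_cancel_left_pos[OF trig] by simp
    then show "\<exists>M. \<forall>m\<ge>M. \<forall>n\<ge>M. norm (x m - x n) < e" by blast
  qed
  then obtain p where p: "x \<longlonglongrightarrow> p" using Cauchy_convergent convergent_def by blast
  have "closed (cylinder :: (real \<times> (real^'n)) set)" unfolding cylinder_def by (intro closed_Times) auto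
  then have pc: "p \<in> cylinder" using cyl p closed_sequentially by blast
  define up where "up q = exp (fst q) *\<^sub>R snd q" for q :: "real \<times> (real^'n)"
  have up: "polar_chart (up q) = q" "up q \<noteq> 0" if "q \<in> cylinder" for q
    using that polar_chart_exp[of q] unfolding up_def cylinder_def by auto
  have lim: "(\<lambda>k. up (x k)) \<longlonglongrightarrow> up p"
    unfolding up_def using p by (intro tendsto_intros)
  have "(\<lambda>k. induced_dist (torus_map \<theta>) (x k) p) \<longlonglongrightarrow> 0"
  proof (rule tendsto_sandwich)
    show "\<forall>\<^sub>F k in sequentially. 0 \<le> induced_dist (torus_map \<theta>) (x k) p"
      using trig by (intro always_eventually allI order_trans[OF _ induced_dist_lower[OF \<theta>]]) simp
    have "\<forall>\<^sub>F k in sequentially. dist (up (x k)) (up p) < norm (up p) / 2"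
      using tendstoD[OF lim, of "norm (up p) / 2"] up(2)[OF pc] by simp
    then show "\<forall>\<^sub>F k in sequentially. induced_dist (torus_map \<theta>) (x k) p
        \<le> ereal (6 * norm (up (x k) - up p) / norm (up p))"
    proof (rule eventually_mono)
      fix k assume "dist (up (x k)) (up p) < norm (up p) / 2"
      then show "induced_dist (torus_map \<theta>) (x k) p \<le> ereal (6 * norm (up (x k) - up p) / norm (up p))"
        using induced_dist_upper[OF \<theta> up(2)[OF pc], of "up (x k)"] up(1) pc cyl by (simp add: dist_norm)
    qed
    have "(\<lambda>k. 6 * norm (up (x k) - up p) / norm (up p)) \<longlonglongrightarrow> 6 * norm (up p - up p) / norm (up p)"
      using lim up(2)[OF pc] by (intro tendsto_intros) auto
    then show "(\<lambda>k. ereal (6 * norm (up (x k) - up p) / norm (up p))) \<longlonglongrightarrow> 0"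
      by (simp add: zero_ereal_def)
  qed simp
  then show "\<exists>p\<in>cylinder. (\<lambda>k. induced_dist (torus_map \<theta>) (x k) p) \<longlonglongrightarrow> 0"
    using pc by blast
qed

section \<open>The diameter of the image\<close>

lemma fs_dist_torus_map_le:
  assumes \<theta>: "0 < \<theta>" "\<theta> < pi / 4" and pq: "p \<in> cylinder" "q \<in> cylinder"
  shows "fs_dist (torus_map \<theta> p) (torus_map \<theta> q) \<le> 2 * \<theta>"
proof -
  have n: "norm (snd p) = 1" "norm (snd q) = 1" using pq by (auto simp: cylinder_def)
  let ?h = "herm (torus_lift \<theta> p) (torus_lift \<theta> q)"
  have 1: "\<bar>snd p \<bullet> snd q\<bar> \<le> 1" using Cauchy_Schwarz_ineq2[of "snd p" "snd q"] n by simp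
  have b: "cmod (of_real ((sin \<theta>)\<^sup>2) * cis (fst p - fst q) * (snd p \<bullet> snd q)) \<le> (sin \<theta>)\<^sup>2"
    using 1 by (simp add: norm_mult mult_left_le norm_power power_abs)
  have "cos (2 * \<theta>) = cmod (of_real ((cos \<theta>)\<^sup>2)) - (sin \<theta>)\<^sup>2"
    by (simp add: cos_double norm_power power_abs)
  also have "\<dots> \<le> cmod ?h"
    unfolding herm_torus_lift using b norm_diff_ineq by (smt (verit))
  finally have lo: "cos (2 * \<theta>) \<le> cmod ?h" .
  have "cmod ?h \<le> cmod (of_real ((cos \<theta>)\<^sup>2)) + (sin \<theta>)\<^sup>2"
    unfolding herm_torus_lift using b norm_triangle_ineq by (smt (verit))
  also have "\<dots> = 1" by (simp add: norm_power power_abs)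
  finally have "arccos (cmod ?h) \<le> arccos (cos (2 * \<theta>))"
    using lo by (intro arccos_le_arccos) (auto intro: order_trans[OF cos_ge_minus_one])
  also have "\<dots> = 2 * \<theta>" using \<theta> by (intro arccos_cos) auto
  finally show ?thesis
    unfolding torus_map_def by (simp add: fs_dist_hopf norm_torus_lift n)
qed

lemma fs_dist_torus_map_attained:
  assumes \<theta>: "0 < \<theta>" "\<theta> < pi / 4"
  obtains p q :: "real \<times> (real^'n::finite)" where "p \<in> cylinder" "q \<in> cylinder"
    "fs_dist (torus_map \<theta> p) (torus_map \<theta> q) = 2 * \<theta>"
proof -
  define e where "e = (axis undefined 1 :: real^'n)"
  have e: "norm e = 1" by (simp add: e_def norm_axis_1)
  \<comment> \<open>Half a turn along the axis makes the phase factor equal to \<open>- 1\<close>.\<close>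
  have "herm (torus_lift \<theta> (pi, e)) (torus_lift \<theta> (0, e)) = complex_of_real (cos (2 * \<theta>))"
    unfolding herm_torus_lift by (simp add: e dot_square_norm cos_double)
  moreover have "0 < cos (2 * \<theta>)" using \<theta> by (intro cos_gt_zero) auto
  ultimately have "fs_dist (torus_map \<theta> (pi, e)) (torus_map \<theta> (0, e)) = arccos (cos (2 * \<theta>))"
    unfolding torus_map_def by (subst fs_dist_hopf) (auto simp: norm_torus_lift e simp del: cos_of_real)
  also have "\<dots> = 2 * \<theta>" using \<theta> by (intro arccos_cos) auto
  finally show thesis using that[of "(pi, e)" "(0, e)"] e by (simp add: cylinder_def)
qed

text \<open>An isometry between two images carries a pair of points at maximal distance to a pair at the
  same distance, so neither diameter exceeds the other.\<close>

lemma torus_parameter_unique: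
  assumes \<theta>: "0 < \<theta>" "\<theta> < pi / 4" and \<eta>: "0 < \<eta>" "\<eta> < pi / 4"
    and congr: "congruent_images (torus_map \<theta> :: real \<times> (real^'n::finite) \<Rightarrow> _) (torus_map \<eta>)"
  shows "\<theta> = \<eta>"
proof -
  let ?C = "cylinder :: (real \<times> (real^'n)) set"
  obtain \<Phi> where \<Phi>: "\<And>a b. fs_dist (\<Phi> a) (\<Phi> b) = fs_dist a b"
      and im: "\<Phi> ` torus_map \<theta> ` ?C = torus_map \<eta> ` ?C"
    using congr unfolding congruent_images_def fs_isometry_def by auto
  show ?thesis
  proof (rule antisym)
    obtain p q where pq: "p \<in> ?C" "q \<in> ?C" "fs_dist (torus_map \<theta> p) (torus_map \<theta> q) = 2 * \<theta>"
      using fs_dist_torus_map_attained[OF \<theta>] .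
    obtain p' where p': "p' \<in> ?C" "\<Phi> (torus_map \<theta> p) = torus_map \<eta> p'"
      using im pq(1) by blast
    obtain q' where q': "q' \<in> ?C" "\<Phi> (torus_map \<theta> q) = torus_map \<eta> q'"
      using im pq(2) by blast
    have "2 * \<theta> = fs_dist (torus_map \<eta> p') (torus_map \<eta> q')"
      using \<Phi>[of "torus_map \<theta> p" "torus_map \<theta> q"] pq(3) p'(2) q'(2) by simp
    then show "\<theta> \<le> \<eta>" using fs_dist_torus_map_le[OF \<eta> p'(1) q'(1)] by simp
  next
    obtain p q where pq: "p \<in> ?C" "q \<in> ?C" "fs_dist (torus_map \<eta> p) (torus_map \<eta> q) = 2 * \<eta>"
      using fs_dist_torus_map_attained[OF \<eta>] .
    have "torus_map \<eta> p \<in> \<Phi> ` torus_map \<theta> ` ?C" "torus_map \<eta> q \<in> \<Phi> ` torus_map \<theta> ` ?C"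
      unfolding im using pq by auto
    then obtain p' q' where p': "p' \<in> ?C" "torus_map \<eta> p = \<Phi> (torus_map \<theta> p')"
      and q': "q' \<in> ?C" "torus_map \<eta> q = \<Phi> (torus_map \<theta> q')" by (elim imageE) blast
    have "2 * \<eta> = fs_dist (torus_map \<theta> p') (torus_map \<theta> q')"
      using \<Phi>[of "torus_map \<theta> p'" "torus_map \<theta> q'"] pq(3) p'(2) q'(2) by simp
    then show "\<eta> \<le> \<theta>" using fs_dist_torus_map_le[OF \<theta> p'(1) q'(1)] by simp
  qed
qed

theorem theorem3p2:
  shows "\<exists>\<F> :: (real \<times> (real^'n::finite) \<Rightarrow> 'n option cproj) set.
    infinite \<F> \<and>
    (\<forall>f\<in>\<F>. lagrangian_immersion f \<and> complete_immersion f \<and> H_minimal f \<and> \<not> minimal f) \<and>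
    (\<forall>f\<in>\<F>. \<forall>g\<in>\<F>. f \<noteq> g \<longrightarrow> \<not> congruent_images f g)"
proof -
  let ?T = "torus_map :: real \<Rightarrow> real \<times> (real^'n) \<Rightarrow> 'n option cproj"
  let ?I = "{0<..<pi/4}"
  have congr: "\<theta> = \<eta>" if "\<theta> \<in> ?I" "\<eta> \<in> ?I" "congruent_images (?T \<theta>) (?T \<eta>)" for \<theta> \<eta>
    using that torus_parameter_unique[of \<theta> \<eta>] by auto
  have "inj_on ?T ?I"
  proof (rule inj_onI)
    fix \<theta> \<eta> assume I: "\<theta> \<in> ?I" "\<eta> \<in> ?I" and eq: "?T \<theta> = ?T \<eta>"
    have "congruent_images (?T \<theta>) (?T \<eta>)"
      unfolding congruent_images_def eq by (intro exI[of _ id]) (simp add: fs_isometry_def)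
    then show "\<theta> = \<eta>" using congr I by blast
  qed
  then have "infinite (?T ` ?I)"
    by (simp add: finite_image_iff infinite_Ioo)
  moreover have "\<not> minimal (?T \<theta>)" if "\<theta> \<in> ?I" for \<theta>
  proof (rule not_minimal_torus_map)
    have "0 < cos (2 * \<theta>)" using that by (intro cos_gt_zero) auto
    then have "1 < 2 * (cos \<theta>)\<^sup>2" by (simp add: cos_double_cos)
    also have "\<dots> \<le> (CARD('n) + 1) * (cos \<theta>)\<^sup>2"
      by (intro mult_right_mono) (auto simp: Suc_leI)
    finally show "(CARD('n) + 1) * (cos \<theta>)\<^sup>2 \<noteq> 1" by simp
  qed (use that in auto)
  moreover have "lagrangian_immersion (?T \<theta>)" "complete_immersion (?T \<theta>)" "H_minimal (?T \<theta>)" if "\<theta> \<in> ?I" for \<theta>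
    using that by (auto intro!: lagrangian_torus_map complete_torus_map H_minimal_torus_map)
  ultimately show ?thesis
    using congr by (intro exI[of _ "?T ` ?I"]) blast
qed

end
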